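(* The theory $\mathsf{PA}^-$ has a completion that is axiomatised by a single sentence plus a set of $\Sigma_1$-sentences. That is, there exist a sentence $\Phi$ of the language of arithmetic and a set $\mathcal X$ of $\Sigma_1$-sentences such that the deductive closure of $\{\Phi\}\cup\mathcal X$ is a consistent complete theory containing $\mathsf{PA}^-$.
   Context: The language of arithmetic has signature $\{0,1,+,\times,<\}$. $\mathsf{PA}^-$ is the theory of non-negative parts of discretely ordered commutative rings, axiomatised by (the universal closures of): $(x+y)+z=x+(y+z)$; $x+y=y+x$; $(xy)z=x(yz)$; $xy=yx$; $x(y+z)=xy+xz$; $x+0=x\wedge x\cdot 0=0$; $x\cdot 1=x$; $(x<y\wedge y<z)\to x<z$; $\neg\,x<x$; $x<y\vee x=y\vee y<x$; $x<y\to x+z<y+z$; $(0<z\wedge x<y)\to xz<yz$; $x<y\to\exists z\,(x+z=y)$; $0<1\wedge(0<x\to(x=1\vee 1<x))$; $x=0\vee 0<x$. A formula is $\Delta_0$ if all its quantifiers are bounded (of the form $\forall y\le x$, $\exists y\le x$). A $\Sigma_1$-formula is a $\Delta_0$-formula prefixed by a (possibly empty) block of existential quantifiers. A completion of a theory $T$ is a consistent complete theory in the same language extending $T$. *)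

theory Defs
  imports Main
begin

section \<open>First-order logic with equality in the language of arithmetic\<close>

text \<open>Variables are de Bruijn indices: \<open>Var 0\<close> belongs to the innermost enclosing quantifier.\<close>

datatype tm = Var nat | Zero | One | Add tm tm | Mul tm tm

datatype fm =
    Falsum
  | Eq tm tm
  | Less tm tm
  | Imp fm fm
  | Conj fm fm
  | Disj fm fm
  | Forall fm
  | Exists fm

abbreviation Neg :: "fm \<Rightarrow> fm" where
  "Neg p \<equiv> Imp p Falsum"

abbreviation Leq :: "tm \<Rightarrow> tm \<Rightarrow> fm" where
  "Leq s t \<equiv> Disj (Less s t) (Eq s t)"

primrec fv_tm :: "tm \<Rightarrow> nat set" where
  "fv_tm (Var i) = {i}"
| "fv_tm Zero = {}"
| "fv_tm One = {}"
| "fv_tm (Add s t) = fv_tm s \<union> fv_tm t"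
| "fv_tm (Mul s t) = fv_tm s \<union> fv_tm t"

primrec fv :: "fm \<Rightarrow> nat set" where
  "fv Falsum = {}"
| "fv (Eq s t) = fv_tm s \<union> fv_tm t"
| "fv (Less s t) = fv_tm s \<union> fv_tm t"
| "fv (Imp p q) = fv p \<union> fv q"
| "fv (Conj p q) = fv p \<union> fv q"
| "fv (Disj p q) = fv p \<union> fv q"
| "fv (Forall p) = {i. Suc i \<in> fv p}"
| "fv (Exists p) = {i. Suc i \<in> fv p}"

definition sentence :: "fm \<Rightarrow> bool" where
  "sentence p \<longleftrightarrow> fv p = {}"

primrec subst_tm :: "(nat \<Rightarrow> tm) \<Rightarrow> tm \<Rightarrow> tm" where
  "subst_tm \<sigma> (Var i) = \<sigma> i"
| "subst_tm \<sigma> Zero = Zero"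
| "subst_tm \<sigma> One = One"
| "subst_tm \<sigma> (Add s t) = Add (subst_tm \<sigma> s) (subst_tm \<sigma> t)"
| "subst_tm \<sigma> (Mul s t) = Mul (subst_tm \<sigma> s) (subst_tm \<sigma> t)"

definition under_binder :: "(nat \<Rightarrow> tm) \<Rightarrow> nat \<Rightarrow> tm" where
  "under_binder \<sigma> = case_nat (Var 0) (\<lambda>i. subst_tm (\<lambda>j. Var (Suc j)) (\<sigma> i))"

primrec subst :: "(nat \<Rightarrow> tm) \<Rightarrow> fm \<Rightarrow> fm" where
  "subst \<sigma> Falsum = Falsum"
| "subst \<sigma> (Eq s t) = Eq (subst_tm \<sigma> s) (subst_tm \<sigma> t)"
| "subst \<sigma> (Less s t) = Less (subst_tm \<sigma> s) (subst_tm \<sigma> t)"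
| "subst \<sigma> (Imp p q) = Imp (subst \<sigma> p) (subst \<sigma> q)"
| "subst \<sigma> (Conj p q) = Conj (subst \<sigma> p) (subst \<sigma> q)"
| "subst \<sigma> (Disj p q) = Disj (subst \<sigma> p) (subst \<sigma> q)"
| "subst \<sigma> (Forall p) = Forall (subst (under_binder \<sigma>) p)"
| "subst \<sigma> (Exists p) = Exists (subst (under_binder \<sigma>) p)"

text \<open>\<open>inst t p\<close> is the body \<open>p\<close> of a quantifier with the bound variable replaced by \<open>t\<close>;
  \<open>lift p\<close> is \<open>p\<close> with its free variables renamed so that index \<open>0\<close> becomes fresh.\<close>

definition inst :: "tm \<Rightarrow> fm \<Rightarrow> fm" where
  "inst t = subst (case_nat t Var)"

definition lift :: "fm \<Rightarrow> fm" where
  "lift = subst (\<lambda>i. Var (Suc i))"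

text \<open>Classical natural deduction. The set of hypotheses may be infinite. The eigenvariable
  conditions of \<open>ForallI\<close> and \<open>ExistsE\<close> are expressed by lifting the hypotheses
  (and, in \<open>ExistsE\<close>, the conclusion), which frees index \<open>0\<close> as eigenvariable.\<close>

inductive proves :: "fm set \<Rightarrow> fm \<Rightarrow> bool" (infix "\<turnstile>" 50) where
  Assm: "p \<in> \<Gamma> \<Longrightarrow> \<Gamma> \<turnstile> p"
| Classical: "insert (Neg p) \<Gamma> \<turnstile> Falsum \<Longrightarrow> \<Gamma> \<turnstile> p"
| ImpI: "insert p \<Gamma> \<turnstile> q \<Longrightarrow> \<Gamma> \<turnstile> Imp p q"
| ImpE: "\<Gamma> \<turnstile> Imp p q \<Longrightarrow> \<Gamma> \<turnstile> p \<Longrightarrow> \<Gamma> \<turnstile> q"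
| ConjI: "\<Gamma> \<turnstile> p \<Longrightarrow> \<Gamma> \<turnstile> q \<Longrightarrow> \<Gamma> \<turnstile> Conj p q"
| ConjE1: "\<Gamma> \<turnstile> Conj p q \<Longrightarrow> \<Gamma> \<turnstile> p"
| ConjE2: "\<Gamma> \<turnstile> Conj p q \<Longrightarrow> \<Gamma> \<turnstile> q"
| DisjI1: "\<Gamma> \<turnstile> p \<Longrightarrow> \<Gamma> \<turnstile> Disj p q"
| DisjI2: "\<Gamma> \<turnstile> q \<Longrightarrow> \<Gamma> \<turnstile> Disj p q"
| DisjE: "\<Gamma> \<turnstile> Disj p q \<Longrightarrow> insert p \<Gamma> \<turnstile> r \<Longrightarrow> insert q \<Gamma> \<turnstile> r \<Longrightarrow> \<Gamma> \<turnstile> r"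
| ForallI: "lift ` \<Gamma> \<turnstile> p \<Longrightarrow> \<Gamma> \<turnstile> Forall p"
| ForallE: "\<Gamma> \<turnstile> Forall p \<Longrightarrow> \<Gamma> \<turnstile> inst t p"
| ExistsI: "\<Gamma> \<turnstile> inst t p \<Longrightarrow> \<Gamma> \<turnstile> Exists p"
| ExistsE: "\<Gamma> \<turnstile> Exists p \<Longrightarrow> insert p (lift ` \<Gamma>) \<turnstile> lift q \<Longrightarrow> \<Gamma> \<turnstile> q"
| EqRefl: "\<Gamma> \<turnstile> Eq t t"
| EqSubst: "\<Gamma> \<turnstile> Eq s t \<Longrightarrow> \<Gamma> \<turnstile> inst s p \<Longrightarrow> \<Gamma> \<turnstile> inst t p"

section \<open>Theories and completions\<close>

definition deductive_closure :: "fm set \<Rightarrow> fm set" where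
  "deductive_closure T = {p. sentence p \<and> T \<turnstile> p}"

definition is_theory :: "fm set \<Rightarrow> bool" where
  "is_theory T \<longleftrightarrow> deductive_closure T = T"

definition consistent :: "fm set \<Rightarrow> bool" where
  "consistent T \<longleftrightarrow> \<not> T \<turnstile> Falsum"

definition complete :: "fm set \<Rightarrow> bool" where
  "complete T \<longleftrightarrow> (\<forall>p. sentence p \<longrightarrow> T \<turnstile> p \<or> T \<turnstile> Neg p)"

definition completion_of :: "fm set \<Rightarrow> fm set \<Rightarrow> bool" where
  "completion_of T S \<longleftrightarrow> is_theory S \<and> consistent S \<and> complete S \<and> T \<subseteq> S"

section \<open>The arithmetical hierarchy\<close>

text \<open>In a bounded quantifier the bound is a variable distinct from the quantified one. Inside the
  scope of the quantifier the latter has index \<open>0\<close>, so the bound has an index \<open>Suc i\<close>.\<close>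

inductive Delta0 :: "fm \<Rightarrow> bool" where
  "Delta0 Falsum"
| "Delta0 (Eq s t)"
| "Delta0 (Less s t)"
| "Delta0 p \<Longrightarrow> Delta0 q \<Longrightarrow> Delta0 (Imp p q)"
| "Delta0 p \<Longrightarrow> Delta0 q \<Longrightarrow> Delta0 (Conj p q)"
| "Delta0 p \<Longrightarrow> Delta0 q \<Longrightarrow> Delta0 (Disj p q)"
| "Delta0 p \<Longrightarrow> Delta0 (Forall (Imp (Leq (Var 0) (Var (Suc i))) p))"
| "Delta0 p \<Longrightarrow> Delta0 (Exists (Conj (Leq (Var 0) (Var (Suc i))) p))"

inductive Sigma1 :: "fm \<Rightarrow> bool" where
  "Delta0 p \<Longrightarrow> Sigma1 p"
| "Sigma1 p \<Longrightarrow> Sigma1 (Exists p)"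

section \<open>The theory of non-negative parts of discretely ordered commutative rings\<close>

abbreviation foralls :: "nat \<Rightarrow> fm \<Rightarrow> fm" where
  "foralls n p \<equiv> (Forall ^^ n) p"

text \<open>In the axioms \<open>Var 0\<close>, \<open>Var 1\<close>, \<open>Var 2\<close> are \<open>x\<close>, \<open>y\<close>, \<open>z\<close>, except that in the scope of the
  existential quantifier of the subtraction axiom \<open>z\<close>, \<open>x\<close>, \<open>y\<close> have the indices 0, 1, 2.\<close>

definition PA_minus_axioms :: "fm set" where
  "PA_minus_axioms = {
     foralls 3 (Eq (Add (Add (Var 0) (Var 1)) (Var 2)) (Add (Var 0) (Add (Var 1) (Var 2)))),
     foralls 2 (Eq (Add (Var 0) (Var 1)) (Add (Var 1) (Var 0))),
     foralls 3 (Eq (Mul (Mul (Var 0) (Var 1)) (Var 2)) (Mul (Var 0) (Mul (Var 1) (Var 2)))),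
     foralls 2 (Eq (Mul (Var 0) (Var 1)) (Mul (Var 1) (Var 0))),
     foralls 3 (Eq (Mul (Var 0) (Add (Var 1) (Var 2)))
                   (Add (Mul (Var 0) (Var 1)) (Mul (Var 0) (Var 2)))),
     foralls 1 (Conj (Eq (Add (Var 0) Zero) (Var 0)) (Eq (Mul (Var 0) Zero) Zero)),
     foralls 1 (Eq (Mul (Var 0) One) (Var 0)),
     foralls 3 (Imp (Conj (Less (Var 0) (Var 1)) (Less (Var 1) (Var 2))) (Less (Var 0) (Var 2))),
     foralls 1 (Neg (Less (Var 0) (Var 0))),
     foralls 2 (Disj (Less (Var 0) (Var 1)) (Disj (Eq (Var 0) (Var 1)) (Less (Var 1) (Var 0)))),
     foralls 3 (Imp (Less (Var 0) (Var 1)) (Less (Add (Var 0) (Var 2)) (Add (Var 1) (Var 2)))),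
     foralls 3 (Imp (Conj (Less Zero (Var 2)) (Less (Var 0) (Var 1)))
                    (Less (Mul (Var 0) (Var 2)) (Mul (Var 1) (Var 2)))),
     foralls 2 (Imp (Less (Var 0) (Var 1)) (Exists (Eq (Add (Var 1) (Var 0)) (Var 2)))),
     foralls 1 (Conj (Less Zero One)
                     (Imp (Less Zero (Var 0)) (Disj (Eq (Var 0) One) (Less One (Var 0))))),
     foralls 1 (Disj (Eq (Var 0) Zero) (Less Zero (Var 0)))
   }"

definition PA_minus :: "fm set" where
  "PA_minus = deductive_closure PA_minus_axioms"

end

theory Submission
  imports Defs "HOL-Library.Countable" "HOL-Computational_Algebra.Polynomial" "HOL-Number_Theory.Cong"
begin

text \<open>
  The completion is the theory of \<open>M\<close>, the non-negative part of \<open>\<int>[X]\<close>, ordered by eventual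
  dominance. A \<open>\<Delta>\<^sub>0\<close> formula pins down the elements \<open>c = X + m\<close> with \<open>m \<in> \<int>\<close>; below such a \<open>c\<close>
  the standard natural numbers are the elements \<open>n\<close> such that every \<open>w \<le> n\<close> is even or odd. Hence
  all of first-order arithmetic can be expressed by bounded quantifiers. In particular a polynomial
  is coded, below \<open>c\<^sup>3\<close>, by the coefficients of a shift of it, through Goedel's beta function, and
  on codes the ring operations, the order and equality are evaluated pointwise at all large
  numbers. On the other hand the value of \<open>x \<in> M\<close> at a number \<open>i\<close> is its remainder modulo
  \<open>c - i\<close>. So one sentence \<open>\<Phi>\<close> can say that
  the universe is isomorphic to the bounded structure of codes, and \<open>\<Phi>\<close> makes every sentence \<open>p\<close>
  equivalent to the \<open>\<Sigma>\<^sub>1\<close> sentence asserting \<open>p\<close> of the codes. Thus \<open>\<Phi>\<close> and the true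
  translations axiomatise the theory of \<open>M\<close>.
\<close>

section \<open>Substitution\<close>

text \<open>The failure of induction in M is the resource: a bounded formula separates the standard
  numbers from X only because X is neither even nor odd, and above this cut there is room for codes
  of all elements below one fixed element. The parameter c cannot be singled out, since X \<mapsto>
  X + 1 induces an automorphism of M; hence \<Phi> speaks about every c satisfying the \<Delta>_0
  condition and the \<Sigma>_1 sentence about some such c. An arbitrary model of \<Phi> may contain
  nonstandard elements that pass for numbers, and there the coding is not understood. Therefore
  \<Phi> states outright the properties of codes and values that the induction on formulas consumes,
  and Goedel coding is analysed in M only. That induction is semantic, whereas theories are defined
  by derivability; a completeness theorem for the calculus bridges the gap.\<close>

lemma subst_tm_comp: "subst_tm \<sigma> (subst_tm \<tau> t) = subst_tm (\<lambda>i. subst_tm \<sigma> (\<tau> i)) t"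
  by (induction t) auto

lemma subst_tm_Var [simp]: "subst_tm Var t = t"
  by (induction t) auto

lemma under_binder_simps [simp]:
  "under_binder \<sigma> 0 = Var 0"
  "under_binder \<sigma> (Suc i) = subst_tm (\<lambda>j. Var (Suc j)) (\<sigma> i)"
  by (auto simp: under_binder_def)

lemma under_binder_Var [simp]: "under_binder Var = Var"
  by (auto simp: under_binder_def fun_eq_iff split: nat.split)

lemma subst_Var [simp]: "subst Var p = p"
  by (induction p) auto

lemma under_binder_comp:
  "(\<lambda>i. subst_tm (under_binder \<sigma>) (under_binder \<tau> i)) = under_binder (\<lambda>i. subst_tm \<sigma> (\<tau> i))"
proof
  show "subst_tm (under_binder \<sigma>) (under_binder \<tau> i) = under_binder (\<lambda>i. subst_tm \<sigma> (\<tau> i)) i" for i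
    by (cases i) (simp_all add: subst_tm_comp)
qed

lemma subst_comp: "subst \<sigma> (subst \<tau> p) = subst (\<lambda>i. subst_tm \<sigma> (\<tau> i)) p"
  by (induction p arbitrary: \<sigma> \<tau>) (simp_all add: subst_tm_comp under_binder_comp)

lemma subst_tm_cong: "(\<And>i. i \<in> fv_tm t \<Longrightarrow> \<sigma> i = \<tau> i) \<Longrightarrow> subst_tm \<sigma> t = subst_tm \<tau> t"
  by (induction t) auto

lemma subst_cong: "(\<And>i. i \<in> fv p \<Longrightarrow> \<sigma> i = \<tau> i) \<Longrightarrow> subst \<sigma> p = subst \<tau> p"
proof (induction p arbitrary: \<sigma> \<tau>)
  case (Forall p)
  have "subst (under_binder \<sigma>) p = subst (under_binder \<tau>) p"
    using Forall.prems by (intro Forall.IH) (auto simp: under_binder_def split: nat.split)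
  then show ?case by simp
next
  case (Exists p)
  have "subst (under_binder \<sigma>) p = subst (under_binder \<tau>) p"
    using Exists.prems by (intro Exists.IH) (auto simp: under_binder_def split: nat.split)
  then show ?case by simp
next
  case (Imp p q) then show ?case by (metis UnCI fv.simps(4) subst.simps(4))
next
  case (Conj p q) then show ?case by (metis UnCI fv.simps(5) subst.simps(5))
next
  case (Disj p q) then show ?case by (metis UnCI fv.simps(6) subst.simps(6))
qed (auto intro!: subst_tm_cong)

lemma inst_under_binder: "inst t (subst (under_binder \<sigma>) p) = subst (case_nat t \<sigma>) p"
proof -
  have "(\<lambda>i. subst_tm (case_nat t Var) (under_binder \<sigma> i)) = case_nat t \<sigma>"
    by (auto simp: fun_eq_iff subst_tm_comp split: nat.split)
  then show ?thesis by (simp add: inst_def subst_comp)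
qed

lemma subst_inst: "subst \<sigma> (inst t p) = inst (subst_tm \<sigma> t) (subst (under_binder \<sigma>) p)"
  unfolding inst_under_binder unfolding inst_def subst_comp
  by (rule arg_cong[where f="\<lambda>s. subst s p"]) (auto simp: fun_eq_iff split: nat.split)

lemma subst_lift: "subst (under_binder \<sigma>) (lift p) = lift (subst \<sigma> p)"
  by (simp add: lift_def subst_comp)

lemma inst_Var_0_lift: "inst (Var 0) (subst (under_binder (\<lambda>i. Var (Suc i))) p) = p"
proof -
  have "case_nat (Var 0) (\<lambda>i. Var (Suc i)) = Var" by (auto simp: fun_eq_iff split: nat.split)
  then show ?thesis by (simp add: inst_under_binder)
qed

lemma finite_fv_tm [simp]: "finite (fv_tm t)"
  by (induction t) auto

lemma finite_fv [simp]: "finite (fv p)"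
proof (induction p)
  case (Forall p)
  have "fv (Forall p) = Suc -` fv p" by auto
  then show ?case using Forall by (simp add: finite_vimageI)
next
  case (Exists p)
  have "fv (Exists p) = Suc -` fv p" by auto
  then show ?case using Exists by (simp add: finite_vimageI)
qed auto

section \<open>Semantics and soundness\<close>

text \<open>The carrier is a set rather than a type: the polynomial model lives on the nonnegative
  part of \<open>int poly\<close>, the term model on chosen representatives of terms.\<close>

record 'a model =
  dom :: "'a set"
  zero :: 'a
  one :: 'a
  add :: "'a \<Rightarrow> 'a \<Rightarrow> 'a"
  mul :: "'a \<Rightarrow> 'a \<Rightarrow> 'a"
  less :: "'a \<Rightarrow> 'a \<Rightarrow> bool"

definition is_model :: "('a, 'b) model_scheme \<Rightarrow> bool" where
  "is_model M \<longleftrightarrow> zero M \<in> dom M \<and> one M \<in> dom M \<and>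
     (\<forall>x\<in>dom M. \<forall>y\<in>dom M. add M x y \<in> dom M \<and> mul M x y \<in> dom M)"

primrec eval :: "('a, 'b) model_scheme \<Rightarrow> (nat \<Rightarrow> 'a) \<Rightarrow> tm \<Rightarrow> 'a" where
  "eval M e (Var i) = e i"
| "eval M e Zero = zero M"
| "eval M e One = one M"
| "eval M e (Add s t) = add M (eval M e s) (eval M e t)"
| "eval M e (Mul s t) = mul M (eval M e s) (eval M e t)"

primrec sat :: "('a, 'b) model_scheme \<Rightarrow> (nat \<Rightarrow> 'a) \<Rightarrow> fm \<Rightarrow> bool" where
  "sat M e Falsum \<longleftrightarrow> False"
| "sat M e (Eq s t) \<longleftrightarrow> eval M e s = eval M e t"
| "sat M e (Less s t) \<longleftrightarrow> less M (eval M e s) (eval M e t)"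
| "sat M e (Imp p q) \<longleftrightarrow> (sat M e p \<longrightarrow> sat M e q)"
| "sat M e (Conj p q) \<longleftrightarrow> sat M e p \<and> sat M e q"
| "sat M e (Disj p q) \<longleftrightarrow> sat M e p \<or> sat M e q"
| "sat M e (Forall p) \<longleftrightarrow> (\<forall>x\<in>dom M. sat M (case_nat x e) p)"
| "sat M e (Exists p) \<longleftrightarrow> (\<exists>x\<in>dom M. sat M (case_nat x e) p)"

lemma eval_subst: "eval M e (subst_tm \<sigma> t) = eval M (\<lambda>i. eval M e (\<sigma> i)) t"
  by (induction t) auto

lemma eval_in_dom: "is_model M \<Longrightarrow> (\<And>i. e i \<in> dom M) \<Longrightarrow> eval M e t \<in> dom M"
  by (induction t) (auto simp: is_model_def)

lemma eval_under_binder: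
  "(\<lambda>i. eval M (case_nat x e) (under_binder \<sigma> i)) = case_nat x (\<lambda>i. eval M e (\<sigma> i))"
  by (auto simp: fun_eq_iff eval_subst split: nat.split)

lemma sat_subst: "sat M e (subst \<sigma> p) \<longleftrightarrow> sat M (\<lambda>i. eval M e (\<sigma> i)) p"
  by (induction p arbitrary: e \<sigma>) (simp_all add: eval_subst eval_under_binder)

lemma sat_inst: "sat M e (inst t p) \<longleftrightarrow> sat M (case_nat (eval M e t) e) p"
proof -
  have "(\<lambda>i. eval M e (case_nat t Var i)) = case_nat (eval M e t) e"
    by (auto simp: fun_eq_iff split: nat.split)
  then show ?thesis by (simp add: inst_def sat_subst)
qed

lemma sat_lift: "sat M (case_nat x e) (lift p) \<longleftrightarrow> sat M e p"
  by (simp add: lift_def sat_subst)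

theorem soundness:
  assumes "\<Gamma> \<turnstile> p" "is_model M" "\<And>i. e i \<in> dom M" "\<And>q. q \<in> \<Gamma> \<Longrightarrow> sat M e q"
  shows "sat M e p"
  using assms
proof (induction arbitrary: e)
  case (Classical p \<Gamma>) then show ?case by (metis insert_iff sat.simps(1,4))
next
  case (ImpI p \<Gamma> q) then show ?case by auto
next
  case (DisjE \<Gamma> p q r) then show ?case by (metis insert_iff sat.simps(6))
next
  case (ForallI \<Gamma> p)
  have "sat M (case_nat x e) p" if "x \<in> dom M" for x
    using that ForallI.prems by (intro ForallI.IH) (auto simp: sat_lift split: nat.split)
  then show ?case by simp
next
  case (ForallE \<Gamma> p t) then show ?case by (simp add: sat_inst eval_in_dom)
next
  case (ExistsI \<Gamma> t p) then show ?case by (auto simp: sat_inst intro: eval_in_dom)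
next
  case (ExistsE \<Gamma> p q)
  from ExistsE.IH(1)[OF ExistsE.prems] obtain x where x: "x \<in> dom M" "sat M (case_nat x e) p"
    by auto
  have "sat M (case_nat x e) (lift q)"
    using x ExistsE.prems by (intro ExistsE.IH(2)) (auto simp: sat_lift split: nat.split)
  then show ?case by (simp add: sat_lift)
next
  case (EqSubst \<Gamma> s t p)
  then have "eval M e s = eval M e t" "sat M e (inst s p)" by auto
  then show ?case by (simp add: sat_inst)
qed auto

section \<open>Completeness\<close>

lemma weakening: "\<Gamma> \<turnstile> p \<Longrightarrow> \<Gamma> \<subseteq> \<Delta> \<Longrightarrow> \<Delta> \<turnstile> p"
proof (induction arbitrary: \<Delta> rule: proves.induct)
  case (Classical p \<Gamma>) then show ?case by (meson insert_mono proves.Classical)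
next
  case (ImpI p \<Gamma> q) then show ?case by (meson insert_mono proves.ImpI)
next
  case (DisjE \<Gamma> p q r) then show ?case by (meson insert_mono proves.DisjE)
next
  case (ForallI \<Gamma> p) then show ?case by (meson image_mono proves.ForallI)
next
  case (ExistsE \<Gamma> p q) then show ?case by (meson image_mono insert_mono proves.ExistsE)
qed (blast intro: proves.intros)+

lemma proves_subst: "\<Gamma> \<turnstile> p \<Longrightarrow> subst \<sigma> ` \<Gamma> \<turnstile> subst \<sigma> p"
proof (induction arbitrary: \<sigma> rule: proves.induct)
  case (Classical p \<Gamma>) then show ?case by (auto intro: proves.Classical)
next
  case (ImpI p \<Gamma> q) then show ?case by (auto intro: proves.ImpI)
next
  case (ImpE \<Gamma> p q) then show ?case by (auto intro: proves.ImpE)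
next
  case (DisjE \<Gamma> p q r)
  show ?case
    using DisjE.IH[of \<sigma>] by (auto intro: proves.DisjE[of _ "subst \<sigma> p" "subst \<sigma> q"])
next
  case (ForallI \<Gamma> p)
  have "lift ` subst \<sigma> ` \<Gamma> \<turnstile> subst (under_binder \<sigma>) p"
    using ForallI.IH[of "under_binder \<sigma>"] by (simp add: image_image subst_lift)
  then show ?case by (auto intro: proves.ForallI)
next
  case (ForallE \<Gamma> p t) then show ?case by (auto simp: subst_inst intro: proves.ForallE)
next
  case (ExistsI \<Gamma> t p)
  have "subst \<sigma> ` \<Gamma> \<turnstile> inst (subst_tm \<sigma> t) (subst (under_binder \<sigma>) p)"
    using ExistsI.IH[of \<sigma>] by (simp add: subst_inst)
  then show ?case by (auto intro: proves.ExistsI)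
next
  case (ExistsE \<Gamma> p q)
  have "subst \<sigma> ` \<Gamma> \<turnstile> Exists (subst (under_binder \<sigma>) p)"
    using ExistsE.IH(1)[of \<sigma>] by simp
  moreover have "insert (subst (under_binder \<sigma>) p) (lift ` subst \<sigma> ` \<Gamma>) \<turnstile> lift (subst \<sigma> q)"
    using ExistsE.IH(2)[of "under_binder \<sigma>"] by (simp add: image_image subst_lift)
  ultimately show ?case by (rule proves.ExistsE)
next
  case (EqSubst \<Gamma> s t p)
  then have "subst \<sigma> ` \<Gamma> \<turnstile> Eq (subst_tm \<sigma> s) (subst_tm \<sigma> t)"
    "subst \<sigma> ` \<Gamma> \<turnstile> inst (subst_tm \<sigma> s) (subst (under_binder \<sigma>) p)"
    by (auto simp: subst_inst)
  then show ?case by (auto simp: subst_inst intro: proves.EqSubst)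
next
  case (ConjE1 \<Gamma> p q) then show ?case by (auto intro: proves.ConjE1)
next
  case (ConjE2 \<Gamma> p q) then show ?case by (auto intro: proves.ConjE2)
qed (auto intro: proves.intros)

text \<open>Finiteness of derivations is what makes the union of a chain of consistent sets
  consistent.\<close>

lemma proves_finite: "\<Gamma> \<turnstile> p \<Longrightarrow> \<exists>\<Delta>\<subseteq>\<Gamma>. finite \<Delta> \<and> \<Delta> \<turnstile> p"
proof (induction rule: proves.induct)
  case (Assm p \<Gamma>)
  then show ?case by (intro exI[of _ "{p}"]) (auto intro: proves.Assm)
next
  case (Classical p \<Gamma>)
  then obtain \<Delta> where "\<Delta> \<subseteq> insert (Neg p) \<Gamma>" "finite \<Delta>" "\<Delta> \<turnstile> Falsum" by blast
  then have "\<Delta> - {Neg p} \<subseteq> \<Gamma>" "finite (\<Delta> - {Neg p})" "insert (Neg p) (\<Delta> - {Neg p}) \<turnstile> Falsum"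
    by (auto intro: weakening)
  then show ?case by (meson proves.Classical)
next
  case (ImpI p \<Gamma> q)
  then obtain \<Delta> where "\<Delta> \<subseteq> insert p \<Gamma>" "finite \<Delta>" "\<Delta> \<turnstile> q" by blast
  then have "\<Delta> - {p} \<subseteq> \<Gamma>" "finite (\<Delta> - {p})" "insert p (\<Delta> - {p}) \<turnstile> q"
    by (auto intro: weakening)
  then show ?case by (meson proves.ImpI)
next
  case (ImpE \<Gamma> p q)
  then obtain \<Delta>1 \<Delta>2 where "\<Delta>1 \<subseteq> \<Gamma>" "finite \<Delta>1" "\<Delta>1 \<turnstile> Imp p q"
    "\<Delta>2 \<subseteq> \<Gamma>" "finite \<Delta>2" "\<Delta>2 \<turnstile> p" by blast
  then show ?case
    by (intro exI[of _ "\<Delta>1 \<union> \<Delta>2"]) (auto intro: weakening proves.ImpE[of _ p])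
next
  case (ConjI \<Gamma> p q)
  then obtain \<Delta>1 \<Delta>2 where "\<Delta>1 \<subseteq> \<Gamma>" "finite \<Delta>1" "\<Delta>1 \<turnstile> p"
    "\<Delta>2 \<subseteq> \<Gamma>" "finite \<Delta>2" "\<Delta>2 \<turnstile> q" by blast
  then show ?case
    by (intro exI[of _ "\<Delta>1 \<union> \<Delta>2"]) (auto intro: weakening proves.ConjI)
next
  case (DisjE \<Gamma> p q r)
  then obtain \<Delta>1 \<Delta>2 \<Delta>3 where *: "\<Delta>1 \<subseteq> \<Gamma>" "finite \<Delta>1" "\<Delta>1 \<turnstile> Disj p q"
    "\<Delta>2 \<subseteq> insert p \<Gamma>" "finite \<Delta>2" "\<Delta>2 \<turnstile> r" "\<Delta>3 \<subseteq> insert q \<Gamma>" "finite \<Delta>3" "\<Delta>3 \<turnstile> r"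
    by metis
  let ?\<Delta> = "\<Delta>1 \<union> (\<Delta>2 - {p}) \<union> (\<Delta>3 - {q})"
  have "?\<Delta> \<turnstile> Disj p q" "insert p ?\<Delta> \<turnstile> r" "insert q ?\<Delta> \<turnstile> r"
    using *(3,6,9) by (auto intro: weakening)
  then have "?\<Delta> \<turnstile> r" by (rule proves.DisjE)
  then show ?case using * by (intro exI[of _ ?\<Delta>]) auto
next
  case (ForallI \<Gamma> p)
  then obtain \<Delta> where "\<Delta> \<subseteq> lift ` \<Gamma>" "finite \<Delta>" "\<Delta> \<turnstile> p" by blast
  then show ?case by (metis finite_subset_image proves.ForallI)
next
  case (ExistsE \<Gamma> p q)
  then obtain \<Delta>1 \<Delta>2 where *: "\<Delta>1 \<subseteq> \<Gamma>" "finite \<Delta>1" "\<Delta>1 \<turnstile> Exists p"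
    "\<Delta>2 \<subseteq> insert p (lift ` \<Gamma>)" "finite \<Delta>2" "\<Delta>2 \<turnstile> lift q" by metis
  then have "\<Delta>2 - {p} \<subseteq> lift ` \<Gamma>" "finite (\<Delta>2 - {p})" by auto
  \<comment> \<open>The eigenvariable rule needs hypotheses that are lifts, hence a finite preimage
    under \<open>lift\<close>.\<close>
  then obtain \<Delta> where \<Delta>: "\<Delta> \<subseteq> \<Gamma>" "finite \<Delta>" "\<Delta>2 - {p} = lift ` \<Delta>"
    by (metis finite_subset_image)
  have "\<Delta>1 \<union> \<Delta> \<turnstile> Exists p" using *(3) by (auto intro: weakening)
  moreover have "insert p (lift ` (\<Delta>1 \<union> \<Delta>)) \<turnstile> lift q"
    by (rule weakening[OF *(6)]) (use \<Delta>(3) in blast)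
  ultimately have "\<Delta>1 \<union> \<Delta> \<turnstile> q" by (rule proves.ExistsE)
  then show ?case using * \<Delta> by (intro exI[of _ "\<Delta>1 \<union> \<Delta>"]) auto
next
  case (EqSubst \<Gamma> s t p)
  then obtain \<Delta>1 \<Delta>2 where "\<Delta>1 \<subseteq> \<Gamma>" "finite \<Delta>1" "\<Delta>1 \<turnstile> Eq s t"
    "\<Delta>2 \<subseteq> \<Gamma>" "finite \<Delta>2" "\<Delta>2 \<turnstile> inst s p" by blast
  then show ?case
    by (intro exI[of _ "\<Delta>1 \<union> \<Delta>2"]) (auto intro: weakening proves.EqSubst[of _ s])
qed (meson proves.intros finite.emptyI empty_subsetI)+

section \<open>Henkin extension of a consistent set of sentences\<close>

instance tm :: countable by countable_datatype
instance fm :: countable by countable_datatype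

lemma cut: "insert p \<Gamma> \<turnstile> q \<Longrightarrow> \<Gamma> \<turnstile> p \<Longrightarrow> \<Gamma> \<turnstile> q"
  by (meson ImpI ImpE)

lemma FalsumE: "\<Gamma> \<turnstile> Falsum \<Longrightarrow> \<Gamma> \<turnstile> p"
  by (meson Classical weakening subset_insertI)

lemma consistent_insert_cases:
  assumes "consistent \<Gamma>" shows "consistent (insert p \<Gamma>) \<or> consistent (insert (Neg p) \<Gamma>)"
  using assms cut Classical unfolding consistent_def by blast

text \<open>Renaming the fresh variable \<open>k\<close> to 0 and shifting all others turns the hypotheses into their
  lifts, as required by the elimination rule.\<close>

lemma consistent_witness:
  assumes con: "consistent (insert (Exists p) \<Gamma>)"
    and fresh: "k \<notin> fv (Exists p)" "\<And>q. q \<in> \<Gamma> \<Longrightarrow> k \<notin> fv q"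
  shows "consistent (insert (inst (Var k) p) (insert (Exists p) \<Gamma>))"
  unfolding consistent_def
proof
  let ?\<Gamma> = "insert (Exists p) \<Gamma>"
  define \<sigma> where "\<sigma> i = (if i = k then Var 0 else Var (Suc i))" for i
  assume "insert (inst (Var k) p) ?\<Gamma> \<turnstile> Falsum"
  then have "insert (subst \<sigma> (inst (Var k) p)) (subst \<sigma> ` ?\<Gamma>) \<turnstile> Falsum"
    using proves_subst[of _ Falsum \<sigma>] by force
  moreover have "subst \<sigma> (inst (Var k) p) = p"
  proof -
    have "subst \<sigma> (inst (Var k) p) = subst (\<lambda>i. subst_tm \<sigma> (case_nat (Var k) Var i)) p"
      by (simp add: inst_def subst_comp)
    also have "\<dots> = subst Var p"
      using fresh(1) by (intro subst_cong) (auto simp: \<sigma>_def split: nat.split)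
    finally show ?thesis by simp
  qed
  moreover have "subst \<sigma> ` ?\<Gamma> = lift ` ?\<Gamma>"
  proof (rule image_cong[OF refl])
    fix q assume "q \<in> ?\<Gamma>"
    then have "k \<notin> fv q" using fresh by auto
    then show "subst \<sigma> q = lift q"
      unfolding lift_def by (intro subst_cong) (auto simp: \<sigma>_def)
  qed
  ultimately have "insert p (lift ` ?\<Gamma>) \<turnstile> lift Falsum" by (simp add: lift_def)
  moreover have "?\<Gamma> \<turnstile> Exists p" by (simp add: Assm)
  ultimately have "?\<Gamma> \<turnstile> Falsum" by (meson ExistsE)
  then show False using con by (simp add: consistent_def)
qed

definition fresh_var :: "fm set \<Rightarrow> nat" where
  "fresh_var \<Gamma> = (SOME k. \<forall>q\<in>\<Gamma>. k \<notin> fv q)"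

definition witness :: "fm set \<Rightarrow> fm \<Rightarrow> fm set" where
  "witness \<Gamma> p = (case p of Exists q \<Rightarrow> {inst (Var (fresh_var (insert p \<Gamma>))) q} | _ \<Rightarrow> {})"

text \<open>Stage n treats the formula with number n and adds the witness of an existential formula
  at once. Free variables play the role of Henkin constants, so the language is not
  enlarged.\<close>

fun extend :: "fm set \<Rightarrow> nat \<Rightarrow> fm set" where
  "extend T 0 = T"
| "extend T (Suc n) = (let p = from_nat n; \<Gamma> = extend T n in
     if consistent (insert p \<Gamma>) then witness \<Gamma> p \<union> insert p \<Gamma> else \<Gamma>)"

lemma finite_witness: "finite (witness \<Gamma> p)"
  by (auto simp: witness_def split: fm.split)

text \<open>Sentences block no variable, so only the finitely many formulas added to T restrict the
  choice.\<close>

lemma fresh_var: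
  assumes "\<And>p. p \<in> T \<Longrightarrow> sentence p" "finite (\<Gamma> - T)" "q \<in> \<Gamma>"
  shows "fresh_var \<Gamma> \<notin> fv q"
proof -
  have "finite (\<Union>q\<in>\<Gamma> - T. fv q)" using assms by simp
  then obtain k where "k \<notin> (\<Union>q\<in>\<Gamma> - T. fv q)" using ex_new_if_finite infinite_UNIV_nat by blast
  then have "\<forall>q\<in>\<Gamma>. k \<notin> fv q" using assms(1) by (auto simp: sentence_def)
  then have "\<forall>q\<in>\<Gamma>. fresh_var \<Gamma> \<notin> fv q" unfolding fresh_var_def by (rule someI)
  then show ?thesis using assms(3) by blast
qed

lemma extend_finite: "finite (extend T n - T)"
proof (induction n)
  case (Suc n)
  have "extend T (Suc n) - T \<subseteq> witness (extend T n) (from_nat n) \<union> insert (from_nat n) (extend T n - T)"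
    by (auto simp: Let_def split: if_splits)
  then show ?case by (rule finite_subset) (simp add: finite_witness Suc)
qed simp

lemma extend_consistent:
  assumes "\<And>p. p \<in> T \<Longrightarrow> sentence p" "consistent T"
  shows "consistent (extend T n)"
proof (induction n)
  case 0 then show ?case using assms by simp
next
  case (Suc n)
  let ?p = "from_nat n :: fm" and ?\<Gamma> = "extend T n"
  have fin: "finite (insert ?p ?\<Gamma> - T)"
    using extend_finite[of T n] by (simp add: insert_Diff_if)
  have "consistent (witness ?\<Gamma> ?p \<union> insert ?p ?\<Gamma>)" if "consistent (insert ?p ?\<Gamma>)"
  proof (cases "\<exists>q. ?p = Exists q")
    case True
    then obtain q where q: "?p = Exists q" by blast
    have "consistent (insert (inst (Var (fresh_var (insert ?p ?\<Gamma>))) q) (insert (Exists q) ?\<Gamma>))"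
      using that fresh_var[OF assms(1) fin] unfolding q
      by (intro consistent_witness) (auto simp del: fv.simps)
    then show ?thesis by (simp add: witness_def q insert_commute)
  next
    case False
    then have "witness ?\<Gamma> ?p = {}" by (auto simp: witness_def split: fm.split)
    then show ?thesis using that by simp
  qed
  then show ?case using Suc by (simp add: Let_def)
qed

lemma extend_mono: "m \<le> n \<Longrightarrow> extend T m \<subseteq> extend T n"
  by (induction n rule: dec_induct) (auto simp: Let_def)

definition henkin :: "fm set \<Rightarrow> bool" where
  "henkin H \<longleftrightarrow> consistent H \<and> (\<forall>p. p \<in> H \<or> Neg p \<in> H) \<and>
     (\<forall>p. Exists p \<in> H \<longrightarrow> (\<exists>t. inst t p \<in> H))"

lemma henkin_extension:
  assumes T: "\<And>p. p \<in> T \<Longrightarrow> sentence p" "consistent T"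
  obtains H where "henkin H" "T \<subseteq> H"
proof
  let ?H = "\<Union>n. extend T n"
  show "T \<subseteq> ?H" using extend.simps(1) by blast
  have con: "consistent ?H" unfolding consistent_def
  proof
    assume "?H \<turnstile> Falsum"
    then obtain \<Delta> where \<Delta>: "\<Delta> \<subseteq> ?H" "finite \<Delta>" "\<Delta> \<turnstile> Falsum" using proves_finite by blast
    have "\<exists>n. \<Delta> \<subseteq> extend T n" using \<Delta>(2,1)
    proof (induction \<Delta>)
      case (insert p \<Delta>)
      then obtain m n where "p \<in> extend T m" "\<Delta> \<subseteq> extend T n" by auto
      then have "insert p \<Delta> \<subseteq> extend T (max m n)"
        using extend_mono[of m "max m n" T] extend_mono[of n "max m n" T] by auto
      then show ?case by blast
    qed simp
    then obtain n where "extend T n \<turnstile> Falsum" using \<Delta>(3) weakening by blast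
    then show False using extend_consistent[OF T] by (simp add: consistent_def)
  qed
  have step: "p \<in> extend T (Suc (to_nat p)) \<or> \<not> consistent (insert p (extend T (to_nat p)))" for p
    by (simp add: Let_def)
  \<comment> \<open>The two formulas are tested at different stages; both rejections persist in the
    union, which would then be inconsistent.\<close>
  have "p \<in> ?H \<or> Neg p \<in> ?H" for p
  proof (rule ccontr)
    assume "\<not> ?thesis"
    then have "\<not> consistent (insert p (extend T (to_nat p)))"
      "\<not> consistent (insert (Neg p) (extend T (to_nat (Neg p))))"
      using step by blast+
    moreover have "extend T n \<subseteq> ?H" for n by blast
    ultimately have "\<not> consistent (insert p ?H)" "\<not> consistent (insert (Neg p) ?H)"
      unfolding consistent_def by (meson insert_mono weakening)+
    then show False using con consistent_insert_cases by blast
  qed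
  moreover have "\<exists>t. inst t p \<in> ?H" if "Exists p \<in> ?H" for p
  proof -
    let ?n = "to_nat (Exists p)"
    have "insert (Exists p) (extend T ?n) \<subseteq> ?H" using that by blast
    then have "consistent (insert (Exists p) (extend T ?n))"
      using con weakening unfolding consistent_def by blast
    then have "witness (extend T ?n) (Exists p) \<subseteq> extend T (Suc ?n)" by (auto simp: Let_def)
    then show ?thesis unfolding witness_def by (simp del: extend.simps) blast
  qed
  ultimately show "henkin ?H" using con by (simp add: henkin_def)
qed

section \<open>Term model of a Henkin set\<close>

context
  fixes H assumes H: "henkin H"
begin

lemma henkin_deduct: "H \<turnstile> p \<Longrightarrow> p \<in> H"
  using H unfolding henkin_def consistent_def by (meson Assm ImpE)

lemma henkin_iff: "p \<in> H \<longleftrightarrow> H \<turnstile> p"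
  using henkin_deduct Assm by blast

lemma henkin_Neg: "Neg p \<in> H \<longleftrightarrow> p \<notin> H"
  using H unfolding henkin_def consistent_def by (meson Assm ImpE)

lemma henkin_Imp: "Imp p q \<in> H \<longleftrightarrow> (p \<in> H \<longrightarrow> q \<in> H)"
proof
  assume "p \<in> H \<longrightarrow> q \<in> H"
  moreover have "H \<turnstile> Imp p q" if "Neg p \<in> H"
    by (rule ImpI, rule FalsumE, rule ImpE[of _ p]) (use that in \<open>auto intro: Assm\<close>)
  moreover have "H \<turnstile> Imp p q" if "q \<in> H"
    using that by (auto intro: ImpI Assm)
  ultimately show "Imp p q \<in> H" using henkin_Neg henkin_iff by blast
qed (meson henkin_iff ImpE)

lemma henkin_Conj: "Conj p q \<in> H \<longleftrightarrow> p \<in> H \<and> q \<in> H"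
  unfolding henkin_iff by (meson ConjI ConjE1 ConjE2)

lemma henkin_Disj: "Disj p q \<in> H \<longleftrightarrow> p \<in> H \<or> q \<in> H"
proof
  assume a: "Disj p q \<in> H"
  show "p \<in> H \<or> q \<in> H"
  proof (rule ccontr)
    assume "\<not> ?thesis"
    then have n: "Neg p \<in> H" "Neg q \<in> H" by (simp_all add: henkin_Neg)
    have "insert p H \<turnstile> Falsum" "insert q H \<turnstile> Falsum"
      using n by (auto intro: ImpE Assm)
    then have "H \<turnstile> Falsum" using a by (meson Assm DisjE)
    then show False using H by (simp add: henkin_def consistent_def)
  qed
qed (auto simp: henkin_iff intro: DisjI1 DisjI2)

lemma henkin_Exists: "Exists p \<in> H \<longleftrightarrow> (\<exists>t. inst t p \<in> H)"
  using H henkin_iff unfolding henkin_def by (meson ExistsI)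

text \<open>The eigenvariable freed by \<open>ForallI\<close> is itself the witness: instantiating
  the lifted body at \<open>Var 0\<close> gives the body back, which contradicts the lifted
  hypothesis.\<close>

lemma not_Exists_Neg: "insert (Neg (Exists (Neg p))) \<Gamma> \<turnstile> Forall p"
proof (rule ForallI, rule Classical)
  let ?\<Delta> = "insert (Neg p) (lift ` insert (Neg (Exists (Neg p))) \<Gamma>)"
  have "inst (Var 0) (subst (under_binder (\<lambda>i. Var (Suc i))) (Neg p)) = Neg p"
    by (rule inst_Var_0_lift)
  then have "?\<Delta> \<turnstile> Exists (subst (under_binder (\<lambda>i. Var (Suc i))) (Neg p))"
    by (intro ExistsI[where t="Var 0"]) (simp add: Assm)
  moreover have "Neg (Exists (subst (under_binder (\<lambda>i. Var (Suc i))) (Neg p))) \<in> ?\<Delta>"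
    by (auto simp: lift_def)
  ultimately show "?\<Delta> \<turnstile> Falsum" by (meson Assm ImpE)
qed

lemma henkin_Forall: "Forall p \<in> H \<longleftrightarrow> (\<forall>t. inst t p \<in> H)"
proof
  assume a: "\<forall>t. inst t p \<in> H"
  have "Exists (Neg p) \<notin> H"
  proof
    assume "Exists (Neg p) \<in> H"
    then obtain t where "inst t (Neg p) \<in> H" using henkin_Exists by blast
    then have "Neg (inst t p) \<in> H" by (simp add: inst_def)
    then show False using a henkin_Neg by blast
  qed
  then have "Neg (Exists (Neg p)) \<in> H" using henkin_Neg by blast
  then have "H \<turnstile> Forall p" using not_Exists_Neg[of p H] by (simp add: insert_absorb)
  then show "Forall p \<in> H" using henkin_iff by blast
qed (meson henkin_iff ForallE)

lemma henkin_refl: "Eq t t \<in> H"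
  using henkin_iff EqRefl by blast

lemma henkin_eq_subst: "Eq s t \<in> H \<Longrightarrow> inst s p \<in> H \<Longrightarrow> inst t p \<in> H"
  using henkin_iff EqSubst by blast

lemma inst_lifted: "subst_tm (case_nat t Var) (subst_tm (\<lambda>i. Var (Suc i)) s) = s"
  by (simp add: subst_tm_comp)

lemma henkin_sym: "Eq s t \<in> H \<Longrightarrow> Eq t s \<in> H"
  using henkin_eq_subst[of s t "Eq (Var 0) (subst_tm (\<lambda>i. Var (Suc i)) s)"] henkin_refl
  by (simp add: inst_def inst_lifted)

lemma henkin_trans: "Eq s t \<in> H \<Longrightarrow> Eq t u \<in> H \<Longrightarrow> Eq s u \<in> H"
  using henkin_eq_subst[of t u "Eq (subst_tm (\<lambda>i. Var (Suc i)) s) (Var 0)"]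
  by (simp add: inst_def inst_lifted)

text \<open>Leibniz substitution replaces one argument at a time, and everything else is lifted so
  that \<open>Var 0\<close> marks only the hole. Keeping f abstract covers \<open>Add\<close> and
  \<open>Mul\<close>.\<close>

lemma henkin_cong2:
  assumes f: "\<And>\<sigma> s t. subst_tm \<sigma> (f s t) = f (subst_tm \<sigma> s) (subst_tm \<sigma> t)"
    and "Eq s s' \<in> H" "Eq t t' \<in> H"
  shows "Eq (f s t) (f s' t') \<in> H"
proof -
  let ?l = "subst_tm (\<lambda>i. Var (Suc i))"
  have "Eq (f s t) (f s' t) \<in> H"
    using henkin_eq_subst[of s s' "Eq (?l (f s t)) (f (Var 0) (?l t))"] assms(2) henkin_refl
    by (simp add: inst_def f inst_lifted)
  moreover have "Eq (f s' t) (f s' t') \<in> H"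
    using henkin_eq_subst[of t t' "Eq (?l (f s' t)) (f (?l s') (Var 0))"] assms(3) henkin_refl
    by (simp add: inst_def f inst_lifted)
  ultimately show ?thesis by (rule henkin_trans)
qed

lemma henkin_less_cong:
  assumes "Eq s s' \<in> H" "Eq t t' \<in> H" "Less s t \<in> H"
  shows "Less s' t' \<in> H"
proof -
  let ?l = "subst_tm (\<lambda>i. Var (Suc i))"
  have "Less s' t \<in> H"
    using henkin_eq_subst[of s s' "Less (Var 0) (?l t)"] assms
    by (simp add: inst_def inst_lifted)
  then show ?thesis
    using henkin_eq_subst[of t t' "Less (?l s') (Var 0)"] assms
    by (simp add: inst_def inst_lifted)
qed

text \<open>Representatives take the place of a quotient: terms equal according to H satisfy the
  same predicate, so \<open>SOME\<close> picks the same term for them.\<close>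

definition rep :: "tm \<Rightarrow> tm" where
  "rep t = (SOME s. Eq t s \<in> H)"

lemma Eq_rep: "Eq t (rep t) \<in> H"
  unfolding rep_def by (rule someI[of _ t]) (rule henkin_refl)

lemma rep_eq_iff: "rep s = rep t \<longleftrightarrow> Eq s t \<in> H"
proof
  assume "rep s = rep t"
  then show "Eq s t \<in> H" by (metis Eq_rep henkin_sym henkin_trans)
next
  assume "Eq s t \<in> H"
  then have "Eq s u \<in> H \<longleftrightarrow> Eq t u \<in> H" for u by (meson henkin_sym henkin_trans)
  then show "rep s = rep t" by (simp add: rep_def)
qed

definition term_model :: "tm model" where
  "term_model = \<lparr>dom = range rep, zero = rep Zero, one = rep One,
     add = (\<lambda>s t. rep (Add s t)), mul = (\<lambda>s t. rep (Mul s t)), less = (\<lambda>s t. Less s t \<in> H)\<rparr>"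

lemma is_model_term_model: "is_model term_model"
  by (auto simp: is_model_def term_model_def)

lemma eval_term_model: "eval term_model (\<lambda>i. rep (\<sigma> i)) t = rep (subst_tm \<sigma> t)"
proof (induction t)
  case (Add s t)
  have "Eq (Add (rep u) (rep v)) (Add u v) \<in> H" for u v
    by (rule henkin_cong2) (auto intro: Eq_rep henkin_sym)
  then show ?case using Add by (simp add: rep_eq_iff) (simp add: term_model_def rep_eq_iff)
next
  case (Mul s t)
  have "Eq (Mul (rep u) (rep v)) (Mul u v) \<in> H" for u v
    by (rule henkin_cong2) (auto intro: Eq_rep henkin_sym)
  then show ?case using Mul by (simp add: rep_eq_iff) (simp add: term_model_def rep_eq_iff)
qed (simp_all add: term_model_def)

text \<open>The truth lemma. It is stated for all substitutions because a quantifier over the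
  domain, which consists of the elements \<open>rep t\<close>, extends \<sigma> by t.\<close>

lemma sat_term_model: "sat term_model (\<lambda>i. rep (\<sigma> i)) p \<longleftrightarrow> subst \<sigma> p \<in> H"
proof (induction p arbitrary: \<sigma>)
  case Falsum
  then show ?case using H by (auto simp: henkin_def consistent_def intro: Assm)
next
  case (Eq s t) then show ?case by (simp add: eval_term_model rep_eq_iff)
next
  case (Less s t)
  have "Less (rep u) (rep v) \<in> H \<longleftrightarrow> Less u v \<in> H" for u v
    by (meson Eq_rep henkin_sym henkin_less_cong)
  then show ?case by (simp add: eval_term_model) (simp add: term_model_def)
next
  case (Forall p)
  have "sat term_model (case_nat (rep t) (\<lambda>i. rep (\<sigma> i))) p \<longleftrightarrow> subst (case_nat t \<sigma>) p \<in> H" for t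
  proof -
    have "case_nat (rep t) (\<lambda>i. rep (\<sigma> i)) = (\<lambda>i. rep (case_nat t \<sigma> i))"
      by (auto split: nat.split)
    then show ?thesis using Forall[of "case_nat t \<sigma>"] by simp
  qed
  then show ?case by (simp add: henkin_Forall inst_under_binder) (simp add: term_model_def)
next
  case (Exists p)
  have "sat term_model (case_nat (rep t) (\<lambda>i. rep (\<sigma> i))) p \<longleftrightarrow> subst (case_nat t \<sigma>) p \<in> H" for t
  proof -
    have "case_nat (rep t) (\<lambda>i. rep (\<sigma> i)) = (\<lambda>i. rep (case_nat t \<sigma> i))"
      by (auto split: nat.split)
    then show ?thesis using Exists[of "case_nat t \<sigma>"] by simp
  qed
  then show ?case by (simp add: henkin_Exists inst_under_binder) (simp add: term_model_def)
qed (simp_all add: henkin_Imp henkin_Conj henkin_Disj)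

end

text \<open>The countermodel is the term model of a Henkin extension, so validity in models over the
  type \<open>tm\<close> suffices. Working with sentences secures the fresh variables of that
  extension.\<close>

theorem completeness:
  assumes T: "\<And>q. q \<in> T \<Longrightarrow> sentence q" and p: "sentence p"
    and valid: "\<And>(M :: tm model) e. is_model M \<Longrightarrow> (\<And>i. e i \<in> dom M) \<Longrightarrow>
      (\<And>q. q \<in> T \<Longrightarrow> sat M e q) \<Longrightarrow> sat M e p"
  shows "T \<turnstile> p"
proof (rule ccontr)
  assume "\<not> T \<turnstile> p"
  then have "consistent (insert (Neg p) T)" unfolding consistent_def using Classical by blast
  moreover have "sentence q" if "q \<in> insert (Neg p) T" for q
    using that T p by (auto simp: sentence_def)
  ultimately obtain H where H: "henkin H" "insert (Neg p) T \<subseteq> H"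
    by (metis henkin_extension)
  let ?M = "term_model H" and ?e = "\<lambda>i. rep H (Var i)"
  have sat: "sat ?M ?e q \<longleftrightarrow> q \<in> H" for q
    using sat_term_model[OF H(1), of Var q] by simp
  have "sat ?M ?e p"
  proof (rule valid)
    show "is_model ?M" using H(1) by (rule is_model_term_model)
    show "?e i \<in> dom ?M" for i by (simp add: term_model_def[OF H(1)])
  qed (use H(2) in \<open>auto simp: sat\<close>)
  then show False using H(2) sat henkin_Neg[OF H(1)] by blast
qed

section \<open>Coding polynomials by triples of natural numbers\<close>

definition beta :: "nat \<Rightarrow> nat \<Rightarrow> nat \<Rightarrow> nat" where
  "beta s t j = s mod (1 + (j + 1) * t)"

text \<open>A common divisor divides (j - i) t and is coprime to t, hence divides j - i and so t
  itself; being a divisor of t coprime to t, it is a unit.\<close>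

lemma coprime_beta_moduli:
  fixes t :: nat
  assumes "i < j" "\<And>d. 0 < d \<Longrightarrow> d \<le> j \<Longrightarrow> d dvd t"
  shows "coprime (1 + (i + 1) * t) (1 + (j + 1) * t)"
proof (rule coprimeI)
  fix d assume d: "d dvd 1 + (i + 1) * t" "d dvd 1 + (j + 1) * t"
  have "1 + (j + 1) * t - (1 + (i + 1) * t) = (j - i) * t"
    by (simp add: diff_mult_distrib)
  then have "d dvd (j - i) * t" using d dvd_diff_nat by metis
  moreover have "coprime d t"
  proof (rule coprimeI)
    fix e assume "e dvd d" "e dvd t"
    then have "e dvd 1 + (i + 1) * t" "e dvd (i + 1) * t" using d(1) by auto
    then show "is_unit e" using dvd_add_left_iff by blast
  qed
  ultimately have "d dvd j - i" by (simp add: coprime_dvd_mult_left_iff)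
  also have "j - i dvd t" using assms by (intro assms(2)) auto
  finally have "d dvd t" .
  then show "is_unit d" using \<open>coprime d t\<close> by (metis coprime_common_divisor dvd_refl)
qed

lemma beta_surj: "\<exists>s t. \<forall>j\<le>n. beta s t j = a j"
proof -
  \<comment> \<open>B bounds n and every \<open>a j\<close>. Thus t = B! is divisible by every
    difference of indices, and each modulus exceeds the remainder it has to produce.\<close>
  define B where "B = n + (\<Sum>j\<le>n. a j)"
  define t where "t = (fact B :: nat)"
  have dvd: "d dvd t" if "0 < d" "d \<le> j" "j \<le> n" for d j
    using that by (auto simp: t_def B_def intro: dvd_fact)
  have "\<forall>i\<in>{..n}. \<forall>j\<in>{..n}. i \<noteq> j \<longrightarrow> coprime (1 + (i + 1) * t) (1 + (j + 1) * t)"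
  proof (intro ballI impI)
    fix i j assume ij: "i \<in> {..n}" "j \<in> {..n}" "i \<noteq> j"
    show "coprime (1 + (i + 1) * t) (1 + (j + 1) * t)"
    proof (cases "i < j")
      case True then show ?thesis using ij dvd by (intro coprime_beta_moduli) auto
    next
      case False
      then have "coprime (1 + (j + 1) * t) (1 + (i + 1) * t)"
        using ij dvd by (intro coprime_beta_moduli) auto
      then show ?thesis by (simp add: coprime_commute)
    qed
  qed
  then obtain s where s: "\<forall>j\<in>{..n}. [s = a j] (mod 1 + (j + 1) * t)"
    using chinese_remainder_nat[of "{..n}" "\<lambda>j. 1 + (j + 1) * t" a] by auto
  have "beta s t j = a j" if "j \<le> n" for j
  proof -
    have "a j \<le> B" using that by (auto simp: B_def intro!: trans_le_add2 member_le_sum)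
    also have "B \<le> t" by (simp add: t_def fact_ge_self)
    also have "t < 1 + (j + 1) * t" by simp
    finally show ?thesis using s that by (simp add: beta_def cong_def)
  qed
  then show ?thesis by blast
qed

section \<open>Evaluation by Horner's scheme\<close>

primrec horner :: "(nat \<Rightarrow> nat) \<Rightarrow> nat \<Rightarrow> nat \<Rightarrow> nat" where
  "horner a x 0 = 0"
| "horner a x (Suc n) = horner a x n * x + a n"

lemma horner_cong: "(\<And>j. j < n \<Longrightarrow> a j = b j) \<Longrightarrow> horner a x n = horner b x n"
  by (induction n) auto

text \<open>The recursion is replaced by the existence of a beta-coded list of its intermediate
  results, a condition expressible in the language of arithmetic.\<close>

lemma horner_iff_beta:
  "horner a x n = v \<longleftrightarrow>
     (\<exists>u w. beta u w 0 = 0 \<and> beta u w n = v \<and> (\<forall>l<n. beta u w (Suc l) = beta u w l * x + a l))"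
proof
  obtain u w where uw: "\<forall>j\<le>n. beta u w j = horner a x j" using beta_surj by blast
  assume "horner a x n = v"
  then show "\<exists>u w. beta u w 0 = 0 \<and> beta u w n = v \<and>
      (\<forall>l<n. beta u w (Suc l) = beta u w l * x + a l)"
    using uw by (intro exI[of _ u] exI[of _ w]) auto
next
  assume "\<exists>u w. beta u w 0 = 0 \<and> beta u w n = v \<and>
      (\<forall>l<n. beta u w (Suc l) = beta u w l * x + a l)"
  then obtain u w where uw: "beta u w 0 = 0" "beta u w n = v"
    "\<forall>l<n. beta u w (Suc l) = beta u w l * x + a l" by blast
  have "j \<le> n \<Longrightarrow> beta u w j = horner a x j" for j
    by (induction j) (use uw in auto)
  then show "horner a x n = v" using uw by auto
qed

text \<open>Horner's scheme consumes the leading coefficient first, hence the reversal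
  \<open>n - 1 - l\<close>; positions above the degree contribute leading zeros.\<close>

lemma poly_eq_horner:
  assumes "degree q < n" "\<And>i. coeff q i \<ge> 0"
  shows "poly q (int x) = int (horner (\<lambda>l. nat (coeff q (n - 1 - l))) x n)"
  using assms
proof (induction n arbitrary: q)
  case (Suc n)
  obtain b r where q: "q = pCons b r" by (cases q)
  have nonneg: "b \<ge> 0" "\<And>i. coeff r i \<ge> 0"
    using Suc.prems(2)[of 0] Suc.prems(2)[of "Suc _"] by (auto simp: q)
  have "poly r (int x) = int (horner (\<lambda>l. nat (coeff r (n - 1 - l))) x n)"
  \<comment> \<open>For r = 0 the degree bound of the induction hypothesis can fail, since n may be
    0.\<close>
  proof (cases "r = 0")
    case True
    have "horner (\<lambda>l. 0) x n = 0" by (induction n) auto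
    then show ?thesis using True by simp
  next
    case False
    then show ?thesis using Suc.prems(1) nonneg(2) by (intro Suc.IH) (auto simp: q)
  qed
  also have "horner (\<lambda>l. nat (coeff r (n - 1 - l))) x n = horner (\<lambda>l. nat (coeff q (n - l))) x n"
  proof (rule horner_cong)
    fix l assume "l < n"
    then have "n - l = Suc (n - 1 - l)" by simp
    then show "nat (coeff r (n - 1 - l)) = nat (coeff q (n - l))" by (simp only: q coeff_pCons_Suc)
  qed
  finally show ?case using nonneg(1) by (simp add: q)
qed simp

primrec horner_poly :: "(nat \<Rightarrow> nat) \<Rightarrow> nat \<Rightarrow> int poly" where
  "horner_poly a 0 = 0"
| "horner_poly a (Suc n) = pCons (int (a n)) (horner_poly a n)"

lemma poly_horner_poly: "poly (horner_poly a n) (int x) = int (horner a x n)"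
  by (induction n) (auto simp: mult.commute)

section \<open>Integer polynomials at large arguments\<close>

text \<open>Both properties are proved together: for p = a + x q the constant coefficient of the
  shift is the value a + k q(k), and every other one is k b + b' for coefficients b, b' of the shift
  of q.\<close>

lemma int_poly_pos_eventually:
  fixes p :: "int poly"
  assumes "p > 0"
  shows "\<exists>K. \<forall>k\<ge>K. (\<forall>i. coeff (pcompose p [:k, 1:]) i \<ge> 0) \<and> poly p k \<ge> 1"
  using assms
proof (induction p)
  case (pCons a q)
  show ?case
  proof (cases "q = 0")
    case True
    then have "a > 0" using pCons.prems by (simp add: less_poly_def pos_poly_pCons)
    then show ?thesis using True by (auto simp: coeff_pCons split: nat.split)
  next
    case False
    then have "q > 0" using pCons.prems by (simp add: less_poly_def pos_poly_pCons)
    then obtain K where K: "\<forall>k\<ge>K. (\<forall>i. coeff (pcompose q [:k, 1:]) i \<ge> 0) \<and> poly q k \<ge> 1"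
      using pCons.IH by blast
    show ?thesis
    \<comment> \<open>The bound 1 keeps products with k nonnegative; the bound 1 - a makes a + k
      q(k) at least 1, because q(k) is at least 1.\<close>
    proof (intro exI[of _ "max K (max 1 (1 - a))"] allI impI)
      fix k assume k: "max K (max 1 (1 - a)) \<le> k"
      let ?q = "pcompose q [:k, 1:]"
      have q: "coeff ?q i \<ge> 0" "poly q k \<ge> 1" for i using K k by auto
      have "k * 1 \<le> k * poly q k" using q k by (intro mult_left_mono) auto
      then have ge: "a + k * poly q k \<ge> 1" using k by linarith
      have "coeff ?q 0 = poly q k" by (metis add.right_neutral mult_zero_left
        poly_0_coeff_0 poly_pCons poly_pcompose)
      then have "coeff (pcompose (pCons a q) [:k, 1:]) i \<ge> 0" for i
        using q k ge by (cases i) (simp_all add: pcompose_pCons)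
      then show "(\<forall>i. coeff (pcompose (pCons a q) [:k, 1:]) i \<ge> 0) \<and> poly (pCons a q) k \<ge> 1"
        using ge by simp
    qed
  qed
qed simp

text \<open>The argument \<open>int i - m\<close> is the point at which c = X + m takes the value
  i.\<close>

lemma int_poly_pos_nat:
  fixes p :: "int poly"
  assumes "p > 0"
  shows "\<exists>N::nat. \<forall>i\<ge>N. poly p (int i - m) > 0"
proof -
  obtain K where K: "\<forall>k\<ge>K. poly p k \<ge> 1" using int_poly_pos_eventually[OF assms] by blast
  have "poly p (int i - m) > 0" if "i \<ge> nat (K + m)" for i
    using K[rule_format, of "int i - m"] that by linarith
  then show ?thesis by blast
qed

lemma int_poly_less_nat:
  fixes p q :: "int poly"
  assumes "p < q"
  shows "\<exists>N::nat. \<forall>i\<ge>N. poly p (int i - m) < poly q (int i - m)"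
  using int_poly_pos_nat[of "q - p" m] assms by simp

lemma int_poly_nonneg_nat:
  fixes p :: "int poly"
  assumes "p \<ge> 0"
  shows "\<exists>N::nat. \<forall>i\<ge>N. poly p (int i - m) \<ge> 0"
proof (cases "p = 0")
  case False
  then show ?thesis using int_poly_pos_nat[of p m] assms by (metis order.order_iff_strict)
qed simp

lemma int_poly_less_iff_nat:
  fixes p q :: "int poly"
  shows "p < q \<longleftrightarrow> (\<exists>N::nat. \<forall>i\<ge>N. poly p (int i - m) < poly q (int i - m))"
proof
  assume "\<exists>N::nat. \<forall>i\<ge>N. poly p (int i - m) < poly q (int i - m)"
  then obtain N :: nat where N: "\<forall>i\<ge>N. poly p (int i - m) < poly q (int i - m)" by blast
  show "p < q"
  proof (rule ccontr)
    assume "\<not> p < q"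
    then obtain N' :: nat where "\<forall>i\<ge>N'. poly (p - q) (int i - m) \<ge> 0"
      using int_poly_nonneg_nat[of "p - q" m] by auto
    then show False using N by (metis diff_ge_0_iff_ge linorder_not_less max.cobounded1 max.cobounded2 poly_diff)
  qed
qed (rule int_poly_less_nat)

lemma int_poly_eq_iff_nat:
  fixes p q :: "int poly"
  shows "p = q \<longleftrightarrow> (\<exists>N::nat. \<forall>i\<ge>N. poly p (int i - m) = poly q (int i - m))"
proof
  assume "\<exists>N::nat. \<forall>i\<ge>N. poly p (int i - m) = poly q (int i - m)"
  then obtain N :: nat where N: "\<forall>i\<ge>N. poly p (int i - m) = poly q (int i - m)" by blast
  have "\<not> p < q" "\<not> q < p" using N int_poly_less_nat[of _ _ m]
    by (metis less_irrefl max.cobounded1 max.cobounded2)+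
  then show "p = q" by simp
qed auto

lemma int_poly_discrete: "(p :: int poly) > 0 \<Longrightarrow> p \<ge> 1"
  by (cases p) (auto simp: less_eq_poly_def less_poly_def one_pCons pos_poly_pCons split: if_splits)

text \<open>After a large shift all coefficients are natural numbers, so a beta-coded list can hold
  them.\<close>

lemma nonneg_poly_code:
  assumes "(p :: int poly) \<ge> 0"
  shows "\<exists>s t n. \<forall>i\<ge>n. poly p (int i - m) = int (horner (beta s t) (i - n) n)"
proof -
  have "\<exists>K. \<forall>k\<ge>K. \<forall>i. coeff (pcompose p [:k, 1:]) i \<ge> 0"
  proof (cases "p = 0")
    case False
    then show ?thesis using int_poly_pos_eventually[of p] assms by (metis order.order_iff_strict)
  qed simp
  then obtain K where K: "\<forall>k\<ge>K. \<forall>i. coeff (pcompose p [:k, 1:]) i \<ge> 0" by blast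
  \<comment> \<open>One number does two jobs: \<open>int n - m\<close> is at least K, so the shifted
    coefficients are nonnegative, and n exceeds the degree, so n coefficients suffice.\<close>
  define n where "n = nat (K + m) + Suc (degree p)"
  let ?q = "pcompose p [:int n - m, 1:]"
  have q: "degree ?q < n" "\<And>i. coeff ?q i \<ge> 0"
    using K by (auto simp: n_def degree_pcompose)
  obtain s t where st: "\<forall>j\<le>n. beta s t j = nat (coeff ?q (n - 1 - j))"
    using beta_surj[of n "\<lambda>j. nat (coeff ?q (n - 1 - j))"] by auto
  have "poly p (int i - m) = int (horner (beta s t) (i - n) n)" if "i \<ge> n" for i
  proof -
    have "poly p (int i - m) = poly ?q (int (i - n))" using that by (simp add: poly_pcompose of_nat_diff)
    also have "\<dots> = int (horner (\<lambda>l. nat (coeff ?q (n - 1 - l))) (i - n) n)"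
      by (rule poly_eq_horner[OF q])
    also have "horner (\<lambda>l. nat (coeff ?q (n - 1 - l))) (i - n) n = horner (beta s t) (i - n) n"
      using st by (intro horner_cong) simp
    finally show ?thesis .
  qed
  then show ?thesis by blast
qed

text \<open>Conversely every coefficient list denotes an element of the model: its values at all
  large arguments are natural numbers, so it cannot be negative.\<close>

lemma poly_code_nonneg:
  "\<exists>p::int poly. p \<ge> 0 \<and> (\<forall>i\<ge>n. poly p (int i - m) = int (horner a (i - n) n))"
proof -
  let ?p = "pcompose (horner_poly a n) [:m - int n, 1:]"
  have *: "poly ?p (int i - m) = int (horner a (i - n) n)" if "i \<ge> n" for i
    using that poly_horner_poly[of a n "i - n"] by (simp add: poly_pcompose of_nat_diff)
  have "\<not> ?p < 0"
  proof
    assume "?p < 0"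
    then obtain N :: nat where "\<forall>i\<ge>N. poly ?p (int i - m) < poly 0 (int i - m)"
      using int_poly_less_nat by blast
    then show False using *[of "max n N"] by (metis max.cobounded1 max.cobounded2 of_nat_0_le_iff linorder_not_less poly_0)
  qed
  then show ?thesis using * by (intro exI[of _ ?p]) (auto simp: not_less)
qed

text \<open>By the factor theorem, p - v vanishes at i - m exactly when c - i divides it. The
  further point is that the quotient lies in the nonnegative part.\<close>

lemma int_poly_remainder:
  fixes p :: "int poly"
  assumes "p \<ge> 0"
  shows "poly p (int i - m) = int v \<longleftrightarrow> (\<exists>w\<ge>0. p = [:int v:] + w * [:m - int i, 1:])"
proof
  assume "poly p (int i - m) = int v"
  then have "poly (p - [:int v:]) (int i - m) = 0" by simp
  then have "[:- (int i - m), 1:] dvd p - [:int v:]" by (simp only: poly_eq_0_iff_dvd)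
  then obtain w where w: "p - [:int v:] = [:- (int i - m), 1:] * w" by (rule dvdE)
  \<comment> \<open>For negative w discreteness gives -w \<ge> 1, so c - i \<le> v - p \<le> v,
    although c - i is infinite.\<close>
  have "w \<ge> 0"
  proof (rule ccontr)
    assume "\<not> w \<ge> 0"
    then have "- w \<ge> 1" by (intro int_poly_discrete) simp
    moreover have pos: "[:m - int i, 1:] \<ge> 0" by (simp add: less_eq_poly_def pos_poly_pCons)
    ultimately have "1 * [:m - int i, 1:] \<le> - w * [:m - int i, 1:]" by (intro mult_right_mono)
    also have "\<dots> = [:int v:] - p" using w by (simp add: algebra_simps)
    also have "\<dots> \<le> [:int v:]" using assms by simp
    finally show False by (simp add: less_eq_poly_def pos_poly_pCons)
  qed
  then show "\<exists>w\<ge>0. p = [:int v:] + w * [:m - int i, 1:]"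
    using w by (intro exI[of _ w]) (simp add: algebra_simps)
qed (auto simp: algebra_simps)

section \<open>The formulas\<close>

abbreviation Iff :: "fm \<Rightarrow> fm \<Rightarrow> fm" where
  "Iff p q \<equiv> Conj (Imp p q) (Imp q p)"

text \<open>All formula builders take the indices of their free variables as arguments, with the parameter
  \<open>c\<close> last; under \<open>n\<close> quantifiers these indices are shifted by \<open>n\<close>.\<close>

definition exB :: "nat \<Rightarrow> fm \<Rightarrow> fm" where
  "exB b p = Exists (Conj (Leq (Var 0) (Var (Suc b))) p)"

definition allB :: "nat \<Rightarrow> fm \<Rightarrow> fm" where
  "allB b p = Forall (Imp (Leq (Var 0) (Var (Suc b))) p)"

definition NatF :: "nat \<Rightarrow> fm" where
  "NatF y = allB y (exB 0 (Disj (Eq (Var 1) (Add (Var 0) (Var 0)))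
                                (Eq (Var 1) (Add (Add (Var 0) (Var 0)) One))))"

text \<open>In the polynomial model every standard number lies below the infinite c, so this bounded
  quantifier ranges over all natural numbers.\<close>

definition exN :: "nat \<Rightarrow> fm \<Rightarrow> fm" where
  "exN c p = exB c (Conj (NatF 0) p)"

definition allN :: "nat \<Rightarrow> fm \<Rightarrow> fm" where
  "allN c p = allB c (Imp (NatF 0) p)"

text \<open>\<open>p\<close> holds of all sufficiently large numbers; in \<open>p\<close> the number has index 0 and the threshold
  index 1.\<close>

definition evF :: "nat \<Rightarrow> fm \<Rightarrow> fm" where
  "evF c p = exN c (allN (c + 1) (Imp (Leq (Var 1) (Var 0)) p))"

text \<open>In the polynomial model this says \<open>c = X + m\<close> for some integer \<open>m\<close>: \<open>c\<close> is infinite, and the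
  infinite elements below it differ from it by a number. The bound \<open>d = c\<^sup>3\<close> exceeds all codes.\<close>

definition deltaF :: "nat \<Rightarrow> nat \<Rightarrow> fm" where
  "deltaF c d = Conj (Eq (Var d) (Mul (Var c) (Mul (Var c) (Var c))))
     (Conj (Neg (NatF c))
       (allB c (Disj (NatF 0) (exN (c + 1) (Eq (Add (Var 1) (Var 0)) (Var (c + 2)))))))"

definition modulus :: "nat \<Rightarrow> nat \<Rightarrow> tm" where
  "modulus w l = Add One (Mul (Add (Var l) One) (Var w))"

definition betaF :: "nat \<Rightarrow> nat \<Rightarrow> nat \<Rightarrow> nat \<Rightarrow> nat \<Rightarrow> fm" where
  "betaF u w l x c = exN c (Conj
     (Eq (Var (u + 1)) (Add (Mul (Var 0) (modulus (w + 1) (l + 1))) (Var (x + 1))))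
     (Less (Var (x + 1)) (modulus (w + 1) (l + 1))))"

text \<open>One step of Horner's scheme at \<open>j\<close> for the coefficients coded by \<open>s\<close>, \<open>t\<close>, where \<open>u\<close>, \<open>w\<close> code
  the intermediate results.\<close>

definition stepF :: "nat \<Rightarrow> nat \<Rightarrow> nat \<Rightarrow> nat \<Rightarrow> nat \<Rightarrow> nat \<Rightarrow> nat \<Rightarrow> fm" where
  "stepF u w s t j l c = exN c (exN (c + 1) (exN (c + 2) (exN (c + 3)
     (Conj (betaF (u + 4) (w + 4) (l + 4) 3 (c + 4))
     (Conj (betaF (s + 4) (t + 4) (l + 4) 2 (c + 4))
     (Conj (Eq (Var 1) (Add (Var (l + 4)) One))
     (Conj (Eq (Var 0) (Add (Mul (Var 3) (Var (j + 4))) (Var 2)))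
       (betaF (u + 4) (w + 4) 1 0 (c + 4)))))))))"

text \<open>Formal counterpart of \<open>horner_iff_beta\<close>. In the initial condition a single
  0 serves both as the position and as the value there.\<close>

definition hornerF :: "nat \<Rightarrow> nat \<Rightarrow> nat \<Rightarrow> nat \<Rightarrow> nat \<Rightarrow> nat \<Rightarrow> fm" where
  "hornerF s t n j v c = exN c (exN (c + 1)
     (Conj (exN (c + 2) (Conj (Eq (Var 0) Zero) (betaF 2 1 0 0 (c + 3))))
     (Conj (betaF 1 0 (n + 2) (v + 2) (c + 2))
       (allN (c + 2) (Imp (Less (Var 0) (Var (n + 3)))
         (stepF 2 1 (s + 3) (t + 3) (j + 3) 0 (c + 3)))))))"

definition packF :: "nat \<Rightarrow> nat \<Rightarrow> nat \<Rightarrow> nat \<Rightarrow> nat \<Rightarrow> fm" where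
  "packF z s t n c = Eq (Var z) (Add (Var s) (Mul (Var c) (Add (Var t) (Mul (Var c) (Var n)))))"

definition codeF :: "nat \<Rightarrow> nat \<Rightarrow> fm" where
  "codeF z c = exN c (exN (c + 1) (exN (c + 2) (packF (z + 3) 2 1 0 (c + 3))))"

text \<open>The element coded by \<open>z = s + tc + nc\<^sup>2\<close> is \<open>Q(X - n)\<close>, where \<open>Q\<close> has the \<open>n\<close> coefficients given
  by \<open>s\<close>, \<open>t\<close>. The shift by \<open>n\<close> makes natural number coefficients sufficient.\<close>

definition valueF :: "nat \<Rightarrow> nat \<Rightarrow> nat \<Rightarrow> nat \<Rightarrow> fm" where
  "valueF z i v c = exN c (exN (c + 1) (exN (c + 2) (exN (c + 3)
     (Conj (packF (z + 4) 3 2 1 (c + 4))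
     (Conj (Eq (Var (i + 4)) (Add (Var 1) (Var 0)))
       (hornerF 3 2 1 0 (v + 4) (c + 4)))))))"

text \<open>\<open>x\<close> is congruent to \<open>v\<close> modulo \<open>c - i\<close>, that is, \<open>v\<close> is the value of \<open>x\<close> at \<open>c = i\<close>.\<close>

definition remF :: "nat \<Rightarrow> nat \<Rightarrow> nat \<Rightarrow> nat \<Rightarrow> fm" where
  "remF x i v c = Exists (Exists (Conj (Eq (Add (Var 1) (Var (i + 2))) (Var (c + 2)))
     (Eq (Var (x + 2)) (Add (Var (v + 2)) (Mul (Var 0) (Var 1))))))"

text \<open>\<open>remF\<close> has unbounded quantifiers, so this link between codes and elements
  may occur in \<open>PhiF\<close> but not in the translation \<open>tr\<close>, which sees codes
  only.\<close>

definition relF :: "nat \<Rightarrow> nat \<Rightarrow> nat \<Rightarrow> fm" where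
  "relF z x c = evF c (allN (c + 2) (Iff (valueF (z + 3) 1 0 (c + 3)) (remF (x + 3) 1 0 (c + 3))))"

definition isNatF :: "nat \<Rightarrow> nat \<Rightarrow> fm" where
  "isNatF x c = Conj (Leq (Var x) (Var c)) (NatF x)"

text \<open>Having eventually the same values is an isomorphism between the universe and the structure of
  codes, and values behave like those of polynomials.\<close>

definition reflectF :: "nat \<Rightarrow> nat \<Rightarrow> fm" where
  "reflectF c d =
    Conj (Forall (exB (d + 1) (Conj (codeF 0 (c + 2)) (relF 0 1 (c + 2)))))
   (Conj (allB d (Imp (codeF 0 (c + 1)) (Exists (relF 1 0 (c + 2)))))
   (Conj (allN c (allN (c + 1) (evF (c + 2) (Conj (Leq (Var 3) (Var 0)) (Leq (Var 2) (Var 0))))))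
   (Conj (Forall (evF (c + 1) (exN (c + 3) (remF 3 1 0 (c + 4)))))
   (Conj (Forall (allN (c + 1) (allN (c + 2) (allN (c + 3)
            (Imp (remF 3 2 1 (c + 4)) (Imp (remF 3 2 0 (c + 4)) (Eq (Var 1) (Var 0))))))))
   (Conj (Forall (Forall (Imp (Eq (Var 1) Zero) (Imp (Eq (Var 0) One)
            (Conj (isNatF 1 (c + 2)) (Conj (isNatF 0 (c + 2))
              (allN (c + 2) (Conj (remF 2 0 2 (c + 3)) (remF 1 0 1 (c + 3))))))))))
   (Conj (Forall (Forall (allN (c + 2) (allN (c + 3) (allN (c + 4)
            (Imp (remF 4 2 1 (c + 5)) (Imp (remF 3 2 0 (c + 5))
              (Forall (Forall (Conj
                (Imp (Eq (Var 1) (Add (Var 6) (Var 5))) (Imp (Eq (Var 0) (Add (Var 3) (Var 2)))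
                   (Conj (isNatF 0 (c + 7)) (remF 1 4 0 (c + 7)))))
                (Imp (Eq (Var 1) (Mul (Var 6) (Var 5))) (Imp (Eq (Var 0) (Mul (Var 3) (Var 2)))
                   (Conj (isNatF 0 (c + 7)) (remF 1 4 0 (c + 7)))))))))))))))
     (Forall (Forall (Conj
       (Iff (Eq (Var 1) (Var 0))
            (evF (c + 2) (exN (c + 4) (Conj (remF 4 1 0 (c + 5)) (remF 3 1 0 (c + 5))))))
       (Iff (Less (Var 1) (Var 0))
            (evF (c + 2) (exN (c + 4) (exN (c + 5) (Conj (remF 5 2 1 (c + 6))
               (Conj (remF 4 2 0 (c + 6)) (Less (Var 1) (Var 0)))))))))))))))))"

text \<open>The first conjunct provides some admissible c; the second makes all of them equally
  good, as none is distinguished.\<close>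

definition PhiF :: fm where
  "PhiF = Conj (Exists (Exists (deltaF 0 1))) (Forall (Forall (Imp (deltaF 0 1) (reflectF 0 1))))"

text \<open>\<open>v\<close> is the value at \<open>i\<close> of the term, where variable \<open>j + r\<close> holds the code of
  variable \<open>j\<close> of the term.\<close>

primrec termF :: "tm \<Rightarrow> nat \<Rightarrow> nat \<Rightarrow> nat \<Rightarrow> nat \<Rightarrow> fm" where
  "termF (Var j) r i v c = valueF (j + r) i v c"
| "termF Zero r i v c = Eq (Var v) Zero"
| "termF One r i v c = Eq (Var v) One"
| "termF (Add s t) r i v c = exN c (exN (c + 1) (Conj (termF s (r + 2) (i + 2) 1 (c + 2))
     (Conj (termF t (r + 2) (i + 2) 0 (c + 2)) (Eq (Var (v + 2)) (Add (Var 1) (Var 0))))))"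
| "termF (Mul s t) r i v c = exN c (exN (c + 1) (Conj (termF s (r + 2) (i + 2) 1 (c + 2))
     (Conj (termF t (r + 2) (i + 2) 0 (c + 2)) (Eq (Var (v + 2)) (Mul (Var 1) (Var 0))))))"

text \<open>\<open>tr k p\<close> asserts \<open>p\<close> of codes, for \<open>p\<close> with free variables below \<open>k\<close>; the parameters \<open>c\<close> and \<open>d\<close>
  have the indices \<open>k\<close> and \<open>k + 1\<close>.\<close>

primrec tr :: "nat \<Rightarrow> fm \<Rightarrow> fm" where
  "tr k Falsum = Falsum"
| "tr k (Eq s t) = evF k (exN (k + 2) (Conj (termF s 3 1 0 (k + 3)) (termF t 3 1 0 (k + 3))))"
| "tr k (Less s t) = evF k (exN (k + 2) (exN (k + 3) (Conj (termF s 4 2 1 (k + 4))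
     (Conj (termF t 4 2 0 (k + 4)) (Less (Var 1) (Var 0))))))"
| "tr k (Imp p q) = Imp (tr k p) (tr k q)"
| "tr k (Conj p q) = Conj (tr k p) (tr k q)"
| "tr k (Disj p q) = Disj (tr k p) (tr k q)"
| "tr k (Forall p) = allB (k + 1) (Imp (codeF 0 (k + 1)) (tr (k + 1) p))"
| "tr k (Exists p) = exB (k + 1) (Conj (codeF 0 (k + 1)) (tr (k + 1) p))"

text \<open>An existential prefix suffices because under \<open>PhiF\<close> the translation has the
  same truth value for every admissible c.\<close>

definition star :: "fm \<Rightarrow> fm" where
  "star p = Exists (Exists (Conj (deltaF 0 1) (tr 0 p)))"

section \<open>Syntactic complexity\<close>

lemma Delta0_exB [simp]: "Delta0 p \<Longrightarrow> Delta0 (exB b p)"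
  by (simp add: exB_def Delta0.intros)

lemma Delta0_allB [simp]: "Delta0 p \<Longrightarrow> Delta0 (allB b p)"
  by (simp add: allB_def Delta0.intros)

declare Delta0.intros(1-6) [simp]

lemma Delta0_NatF [simp]: "Delta0 (NatF y)"
  by (simp add: NatF_def)

lemma Delta0_exN [simp]: "Delta0 p \<Longrightarrow> Delta0 (exN c p)"
  and Delta0_allN [simp]: "Delta0 p \<Longrightarrow> Delta0 (allN c p)"
  by (simp_all add: exN_def allN_def)

lemma Delta0_evF [simp]: "Delta0 p \<Longrightarrow> Delta0 (evF c p)"
  by (simp add: evF_def)

lemma Delta0_codes [simp]:
  "Delta0 (betaF u w l x c)" "Delta0 (stepF u w s t j l c)" "Delta0 (hornerF s t n j v c)" "Delta0 (codeF z c)"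
  "Delta0 (valueF z i v c)" "Delta0 (deltaF c d)"
  by (simp_all add: betaF_def stepF_def hornerF_def codeF_def valueF_def deltaF_def packF_def)

lemma Delta0_termF [simp]: "Delta0 (termF t r i v c)"
  by (induction t arbitrary: r i v c) simp_all

lemma Delta0_tr [simp]: "Delta0 (tr k p)"
  by (induction p arbitrary: k) simp_all

lemma Sigma1_star: "Sigma1 (star p)"
  by (simp add: star_def Sigma1.intros)

lemma fv_exB [simp]: "fv (exB b p) = insert b {i. Suc i \<in> fv p}"
  and fv_allB [simp]: "fv (allB b p) = insert b {i. Suc i \<in> fv p}"
  by (auto simp: exB_def allB_def)

lemma fv_NatF [simp]: "fv (NatF y) = {y}"
  by (auto simp: NatF_def)

lemma fv_exN [simp]: "fv (exN b p) = insert b {i. Suc i \<in> fv p}"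
  and fv_allN [simp]: "fv (allN b p) = insert b {i. Suc i \<in> fv p}"
  by (auto simp: exN_def allN_def)

lemma fv_evF [simp]: "fv (evF c p) = insert c {i. Suc (Suc i) \<in> fv p}"
  by (auto simp: evF_def)

lemma fv_betaF [simp]: "fv (betaF u w l x c) = {u, w, l, x, c}"
  by (auto simp: betaF_def modulus_def)

lemma fv_stepF [simp]: "fv (stepF u w s t j l c) = {u, w, s, t, j, l, c}"
  by (auto simp: stepF_def numeral_eq_Suc)

lemma fv_hornerF [simp]: "fv (hornerF s t n j v c) = {s, t, n, j, v, c}"
  by (auto simp: hornerF_def numeral_eq_Suc)

lemma fv_codeF [simp]: "fv (codeF z c) = {z, c}"
  and fv_valueF [simp]: "fv (valueF z i v c) = {z, i, v, c}"
  and fv_remF [simp]: "fv (remF z i v c) = {z, i, v, c}"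
  and fv_deltaF [simp]: "fv (deltaF c d) = {c, d}"
  and fv_isNatF [simp]: "fv (isNatF x c) = {x, c}"
  by (auto simp: codeF_def valueF_def packF_def remF_def deltaF_def isNatF_def numeral_eq_Suc)

lemma fv_relF [simp]: "fv (relF z x c) = {z, x, c}"
  by (auto simp: relF_def numeral_eq_Suc)

lemma fv_reflectF: "fv (reflectF c d) \<subseteq> {c, d}"
  by (auto simp: reflectF_def numeral_eq_Suc)

lemma sentence_PhiF: "sentence PhiF"
  using fv_reflectF[of 0 1] by (auto simp: sentence_def PhiF_def)

lemma fv_termF: "fv (termF t r i v c) \<subseteq> (\<lambda>j. j + r) ` fv_tm t \<union> {i, v, c}"
proof (induction t arbitrary: r i v c)
  case (Add s t)
  show ?case using Add[of "r + 2" "i + 2" _ "c + 2"] by (fastforce simp: numeral_eq_Suc)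
next
  case (Mul s t)
  show ?case using Mul[of "r + 2" "i + 2" _ "c + 2"] by (fastforce simp: numeral_eq_Suc)
qed auto

lemma fv_tr: "fv p \<subseteq> {..<k} \<Longrightarrow> fv (tr k p) \<subseteq> {..k + 1}"
proof (induction p arbitrary: k)
  case (Eq s t)
  then show ?case
    using fv_termF[of s 3 1 0 "k + 3"] fv_termF[of t 3 1 0 "k + 3"]
    by (fastforce simp: numeral_eq_Suc)
next
  case (Less s t)
  then show ?case
    using fv_termF[of s 4 2 1 "k + 4"] fv_termF[of t 4 2 0 "k + 4"]
    by (fastforce simp: numeral_eq_Suc)
next
  case (Forall p)
  have "fv p \<subseteq> {..<k + 1}" using Forall.prems by (auto simp: subset_iff less_Suc_eq_0_disj)
     (metis not0_implies_Suc)
  then show ?case using Forall.IH[of "k + 1"] by auto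
next
  case (Exists p)
  have "fv p \<subseteq> {..<k + 1}" using Exists.prems by (auto simp: subset_iff less_Suc_eq_0_disj)
     (metis not0_implies_Suc)
  then show ?case using Exists.IH[of "k + 1"] by auto
qed auto

lemma sentence_star: "sentence p \<Longrightarrow> sentence (star p)"
  using fv_tr[of p 0] by (auto simp: sentence_def star_def)

section \<open>Meaning of the formulas\<close>

definition le :: "'a model \<Rightarrow> 'a \<Rightarrow> 'a \<Rightarrow> bool" where
  "le M x y \<longleftrightarrow> less M x y \<or> x = y"

definition natural :: "'a model \<Rightarrow> 'a \<Rightarrow> bool" where
  "natural M x \<longleftrightarrow> (\<forall>w\<in>dom M. le M w x \<longrightarrow>
     (\<exists>h\<in>dom M. le M h w \<and> (w = add M h h \<or> w = add M (add M h h) (one M))))"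

definition nats :: "'a model \<Rightarrow> 'a \<Rightarrow> 'a set" where
  "nats M c = {n \<in> dom M. le M n c \<and> natural M n}"

definition ev :: "'a model \<Rightarrow> 'a \<Rightarrow> ('a \<Rightarrow> bool) \<Rightarrow> bool" where
  "ev M c P \<longleftrightarrow> (\<exists>N\<in>nats M c. \<forall>i\<in>nats M c. le M N i \<longrightarrow> P i)"

text \<open>Kept as bare satisfaction of the formula: in a general model nothing is known about its
  beta function, and it is computed in the polynomial model only.\<close>

definition code_val :: "'a model \<Rightarrow> 'a \<Rightarrow> 'a \<Rightarrow> 'a \<Rightarrow> 'a \<Rightarrow> bool" where
  "code_val M c z i v \<longleftrightarrow> sat M (case_nat z (case_nat i (case_nat v (\<lambda>_. c)))) (valueF 0 1 2 3)"

definition is_code :: "'a model \<Rightarrow> 'a \<Rightarrow> 'a \<Rightarrow> bool" where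
  "is_code M c z \<longleftrightarrow> sat M (case_nat z (\<lambda>_. c)) (codeF 0 1)"

definition remainder :: "'a model \<Rightarrow> 'a \<Rightarrow> 'a \<Rightarrow> 'a \<Rightarrow> 'a \<Rightarrow> bool" where
  "remainder M c x i v \<longleftrightarrow>
     (\<exists>y\<in>dom M. \<exists>w\<in>dom M. add M y i = c \<and> x = add M v (mul M w y))"

definition rel :: "'a model \<Rightarrow> 'a \<Rightarrow> 'a \<Rightarrow> 'a \<Rightarrow> bool" where
  "rel M c z x \<longleftrightarrow> ev M c (\<lambda>i. \<forall>v\<in>nats M c. code_val M c z i v \<longleftrightarrow> remainder M c x i v)"

lemma sat_exB [simp]:
    "sat M e (exB b p) \<longleftrightarrow> (\<exists>x\<in>dom M. le M x (e b) \<and> sat M (case_nat x e) p)"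
  and sat_allB [simp]:
    "sat M e (allB b p) \<longleftrightarrow> (\<forall>x\<in>dom M. le M x (e b) \<longrightarrow> sat M (case_nat x e) p)"
  by (auto simp: exB_def allB_def le_def)

lemma sat_NatF [simp]: "sat M e (NatF y) \<longleftrightarrow> natural M (e y)"
  by (simp add: NatF_def natural_def)

lemma sat_exN [simp]: "sat M e (exN b p) \<longleftrightarrow> (\<exists>x\<in>nats M (e b). sat M (case_nat x e) p)"
  and sat_allN [simp]: "sat M e (allN b p) \<longleftrightarrow> (\<forall>x\<in>nats M (e b). sat M (case_nat x e) p)"
  by (auto simp: exN_def allN_def nats_def)

lemma sat_evF [simp]:
  "sat M e (evF c p) \<longleftrightarrow> (\<exists>N\<in>nats M (e c). \<forall>i\<in>nats M (e c). le M N i \<longrightarrow>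
     sat M (case_nat i (case_nat N e)) p)"
  by (simp add: evF_def le_def)

lemma sat_valueF [simp]: "sat M e (valueF z i v c) \<longleftrightarrow> code_val M (e c) (e z) (e i) (e v)"
  by (simp add: code_val_def valueF_def hornerF_def stepF_def betaF_def packF_def modulus_def numeral_eq_Suc)

lemma sat_codeF [simp]: "sat M e (codeF z c) \<longleftrightarrow> is_code M (e c) (e z)"
  by (simp add: is_code_def codeF_def packF_def numeral_eq_Suc)

lemma sat_remF [simp]: "sat M e (remF x i v c) \<longleftrightarrow> remainder M (e c) (e x) (e i) (e v)"
  by (simp add: remainder_def remF_def numeral_eq_Suc)

lemma sat_isNatF [simp]: "sat M e (isNatF x c) \<longleftrightarrow> le M (e x) (e c) \<and> natural M (e x)"
  by (auto simp: isNatF_def le_def)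

lemma sat_relF [simp]: "sat M e (relF z x c) \<longleftrightarrow> rel M (e c) (e z) (e x)"
  by (auto simp: relF_def rel_def ev_def numeral_eq_Suc)

text \<open>Mirrors \<open>reflectF\<close> clause by clause. Sums, products and constants enter
  through variables with defining equations because \<open>remF\<close> and \<open>isNatF\<close>
  take variable indices rather than terms.\<close>

definition reflects :: "'a model \<Rightarrow> 'a \<Rightarrow> 'a \<Rightarrow> bool" where
  "reflects M c d \<longleftrightarrow>
    (\<forall>x\<in>dom M. \<exists>z\<in>dom M. le M z d \<and> is_code M c z \<and> rel M c z x) \<and>
    (\<forall>z\<in>dom M. le M z d \<longrightarrow> is_code M c z \<longrightarrow> (\<exists>x\<in>dom M. rel M c z x)) \<and>
    (\<forall>a\<in>nats M c. \<forall>b\<in>nats M c. ev M c (\<lambda>i. le M a i \<and> le M b i)) \<and>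
    (\<forall>x\<in>dom M. ev M c (\<lambda>i. \<exists>v\<in>nats M c. remainder M c x i v)) \<and>
    (\<forall>x\<in>dom M. \<forall>i\<in>nats M c. \<forall>v\<in>nats M c. \<forall>w\<in>nats M c.
       remainder M c x i v \<longrightarrow> remainder M c x i w \<longrightarrow> v = w) \<and>
    (\<forall>o'\<in>dom M. \<forall>i\<in>dom M. o' = zero M \<longrightarrow> i = one M \<longrightarrow>
       (le M o' c \<and> natural M o') \<and> (le M i c \<and> natural M i) \<and>
       (\<forall>j\<in>nats M c. remainder M c o' j o' \<and> remainder M c i j i)) \<and>
    (\<forall>x\<in>dom M. \<forall>y\<in>dom M. \<forall>i\<in>nats M c. \<forall>v\<in>nats M c. \<forall>w\<in>nats M c.
       remainder M c x i v \<longrightarrow> remainder M c y i w \<longrightarrow> (\<forall>z\<in>dom M. \<forall>u\<in>dom M.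
       (z = add M x y \<longrightarrow> u = add M v w \<longrightarrow> (le M u c \<and> natural M u) \<and> remainder M c z i u) \<and>
       (z = mul M x y \<longrightarrow> u = mul M v w \<longrightarrow> (le M u c \<and> natural M u) \<and> remainder M c z i u))) \<and>
    (\<forall>x\<in>dom M. \<forall>y\<in>dom M.
       (x = y \<longleftrightarrow> ev M c (\<lambda>i. \<exists>v\<in>nats M c. remainder M c x i v \<and> remainder M c y i v)) \<and>
       (less M x y \<longleftrightarrow> ev M c (\<lambda>i. \<exists>v\<in>nats M c. \<exists>w\<in>nats M c.
          remainder M c x i v \<and> remainder M c y i w \<and> less M v w)))"

definition delta :: "'a model \<Rightarrow> 'a \<Rightarrow> 'a \<Rightarrow> bool" where
  "delta M c d \<longleftrightarrow> d = mul M c (mul M c c) \<and> \<not> natural M c \<and>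
     (\<forall>x\<in>dom M. le M x c \<longrightarrow> natural M x \<or> (\<exists>n\<in>nats M c. add M x n = c))"

lemma sat_deltaF [simp]: "sat M e (deltaF c d) \<longleftrightarrow> delta M (e c) (e d)"
  by (simp add: deltaF_def delta_def numeral_eq_Suc)

lemma sat_reflectF: "sat M e (reflectF c d) \<longleftrightarrow> reflects M (e c) (e d)"
  unfolding reflectF_def reflects_def iff_conv_conj_imp
  by (simp add: numeral_eq_Suc ev_def flip: le_def)

section \<open>Transfer to codes\<close>

locale reflecting =
  fixes M :: "'a model" and c d :: 'a
  assumes M: "is_model M" and c: "c \<in> dom M" and d: "d \<in> dom M" and reflects: "reflects M c d"
begin

lemma in_dom [simp, intro]:
  "zero M \<in> dom M" "one M \<in> dom M"
  "x \<in> dom M \<Longrightarrow> y \<in> dom M \<Longrightarrow> add M x y \<in> dom M"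
  "x \<in> dom M \<Longrightarrow> y \<in> dom M \<Longrightarrow> mul M x y \<in> dom M"
  using M by (auto simp: is_model_def)

lemma nats_in_dom: "n \<in> nats M c \<Longrightarrow> n \<in> dom M"
  by (simp add: nats_def)

lemmas clauses = reflects[unfolded reflects_def, THEN conjunct1]
  reflects[unfolded reflects_def, THEN conjunct2, THEN conjunct1]
  reflects[unfolded reflects_def, THEN conjunct2, THEN conjunct2, THEN conjunct1]
  reflects[unfolded reflects_def, THEN conjunct2, THEN conjunct2, THEN conjunct2, THEN conjunct1]
  reflects[unfolded reflects_def, THEN conjunct2, THEN conjunct2, THEN conjunct2, THEN conjunct2,
    THEN conjunct1]
  reflects[unfolded reflects_def, THEN conjunct2, THEN conjunct2, THEN conjunct2, THEN conjunct2,
    THEN conjunct2, THEN conjunct1]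
  reflects[unfolded reflects_def, THEN conjunct2, THEN conjunct2, THEN conjunct2, THEN conjunct2,
    THEN conjunct2, THEN conjunct2, THEN conjunct1]
  reflects[unfolded reflects_def, THEN conjunct2, THEN conjunct2, THEN conjunct2, THEN conjunct2,
    THEN conjunct2, THEN conjunct2, THEN conjunct2]

lemmas ex_code = clauses(1)[rule_format]
  and ex_elem = clauses(2)[rule_format]
  and ev_ge = clauses(3)[rule_format]
  and ev_remainder = clauses(4)[rule_format]
  and remainder_unique = clauses(5)[rule_format]
  and eq_iff_ev = clauses(8)[rule_format, THEN conjunct1]
  and less_iff_ev = clauses(8)[rule_format, THEN conjunct2]

lemma nats_zero: "zero M \<in> nats M c" and nats_one: "one M \<in> nats M c"
  and remainder_zero: "i \<in> nats M c \<Longrightarrow> remainder M c (zero M) i (zero M)"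
  and remainder_one: "i \<in> nats M c \<Longrightarrow> remainder M c (one M) i (one M)"
  using clauses(6)[rule_format, OF in_dom(1,2) refl refl] by (simp_all add: nats_def)

lemma remainder_arith:
  assumes "x \<in> dom M" "y \<in> dom M" "i \<in> nats M c" "v \<in> nats M c" "w \<in> nats M c"
    and "remainder M c x i v" "remainder M c y i w"
  shows "add M v w \<in> nats M c" "remainder M c (add M x y) i (add M v w)"
    and "mul M v w \<in> nats M c" "remainder M c (mul M x y) i (mul M v w)"
  using clauses(7)[rule_format, OF assms, of "add M x y" "add M v w"]
    clauses(7)[rule_format, OF assms, of "mul M x y" "mul M v w"] assms
  by (simp_all add: nats_in_dom) (simp_all add: nats_def)

text \<open>Thresholds are merged by the third clause of \<open>reflects\<close>, since no order
  axioms are available for M.\<close>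

lemma ev_conj: "ev M c P \<Longrightarrow> ev M c Q \<Longrightarrow> ev M c (\<lambda>i. P i \<and> Q i)"
proof -
  assume "ev M c P" "ev M c Q"
  then obtain a b where ab: "a \<in> nats M c" "b \<in> nats M c"
    "\<And>i. i \<in> nats M c \<Longrightarrow> le M a i \<Longrightarrow> P i" "\<And>i. i \<in> nats M c \<Longrightarrow> le M b i \<Longrightarrow> Q i"
    unfolding ev_def by blast
  then show ?thesis using ev_ge[of a b] unfolding ev_def by blast
qed

lemma ev_mono: "ev M c P \<Longrightarrow> (\<And>i. i \<in> nats M c \<Longrightarrow> P i \<Longrightarrow> Q i) \<Longrightarrow> ev M c Q"
  unfolding ev_def by blast

lemma ev_cong:
  assumes "ev M c (\<lambda>i. P i \<longleftrightarrow> Q i)"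
  shows "ev M c P \<longleftrightarrow> ev M c Q"
proof
  show "ev M c P \<Longrightarrow> ev M c Q" "ev M c Q \<Longrightarrow> ev M c P"
    using assms by (auto elim: ev_mono[OF ev_conj])
qed

lemma ev_const: "(\<And>i. i \<in> nats M c \<Longrightarrow> P i) \<Longrightarrow> ev M c P"
  unfolding ev_def using nats_zero by blast

definition term_at :: "tm \<Rightarrow> (nat \<Rightarrow> 'a) \<Rightarrow> 'a \<Rightarrow> 'a \<Rightarrow> bool" where
  "term_at t z i v \<longleftrightarrow> sat M (case_nat i (case_nat v (case_nat c z))) (termF t 3 0 1 2)"

text \<open>Only the values found at the used indices matter. This reconciles the shifted indices
  under quantifiers with the fixed layout of \<open>term_at\<close>.\<close>

lemma sat_termF:
  assumes "\<And>j. j \<in> fv_tm t \<Longrightarrow> e (j + r) = e' (j + r')" "e i = e' i'" "e v = e' v'" "e k = e' k'"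
  shows "sat M e (termF t r i v k) \<longleftrightarrow> sat M e' (termF t r' i' v' k')"
  using assms
proof (induction t arbitrary: e e' r r' i i' v v' k k')
  case (Add s t)
  have "sat M (case_nat b (case_nat a e)) (termF s (r + 2) (i + 2) 1 (k + 2)) \<longleftrightarrow>
        sat M (case_nat b (case_nat a e')) (termF s (r' + 2) (i' + 2) 1 (k' + 2))" for a b
    by (rule Add.IH(1)) (simp_all add: Add.prems)
  moreover have "sat M (case_nat b (case_nat a e)) (termF t (r + 2) (i + 2) 0 (k + 2)) \<longleftrightarrow>
        sat M (case_nat b (case_nat a e')) (termF t (r' + 2) (i' + 2) 0 (k' + 2))" for a b
    by (rule Add.IH(2)) (simp_all add: Add.prems)
  ultimately show ?case using Add.prems by simp
next
  case (Mul s t)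
  have "sat M (case_nat b (case_nat a e)) (termF s (r + 2) (i + 2) 1 (k + 2)) \<longleftrightarrow>
        sat M (case_nat b (case_nat a e')) (termF s (r' + 2) (i' + 2) 1 (k' + 2))" for a b
    by (rule Mul.IH(1)) (simp_all add: Mul.prems)
  moreover have "sat M (case_nat b (case_nat a e)) (termF t (r + 2) (i + 2) 0 (k + 2)) \<longleftrightarrow>
        sat M (case_nat b (case_nat a e')) (termF t (r' + 2) (i' + 2) 0 (k' + 2))" for a b
    by (rule Mul.IH(2)) (simp_all add: Mul.prems)
  ultimately show ?case using Mul.prems by simp
qed simp_all

lemma term_at_simps:
  "term_at (Var j) z i v \<longleftrightarrow> code_val M c (z j) i v"
  "term_at Zero z i v \<longleftrightarrow> v = zero M"
  "term_at One z i v \<longleftrightarrow> v = one M"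
  "term_at (Add s t) z i v \<longleftrightarrow>
     (\<exists>a\<in>nats M c. \<exists>b\<in>nats M c. term_at s z i a \<and> term_at t z i b \<and> v = add M a b)"
  "term_at (Mul s t) z i v \<longleftrightarrow>
     (\<exists>a\<in>nats M c. \<exists>b\<in>nats M c. term_at s z i a \<and> term_at t z i b \<and> v = mul M a b)"
proof -
  have *: "sat M (case_nat b (case_nat a (case_nat i (case_nat v (case_nat c z)))))
      (termF u (Suc (Suc 3)) 2 k 4) \<longleftrightarrow> term_at u z i (case_nat b (\<lambda>_. a) k)" if "k < 2" for u a b k
    unfolding term_at_def using that
    by (intro sat_termF) (auto simp: numeral_eq_Suc less_Suc_eq split: nat.split)
  show "term_at (Add s t) z i v \<longleftrightarrow>
     (\<exists>a\<in>nats M c. \<exists>b\<in>nats M c. term_at s z i a \<and> term_at t z i b \<and> v = add M a b)"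
    "term_at (Mul s t) z i v \<longleftrightarrow>
     (\<exists>a\<in>nats M c. \<exists>b\<in>nats M c. term_at s z i a \<and> term_at t z i b \<and> v = mul M a b)"
    using *[of 0] *[of 1] by (simp_all add: term_at_def[of "Add _ _"] term_at_def[of "Mul _ _"] numeral_eq_Suc)
qed (simp_all add: term_at_def numeral_eq_Suc)

text \<open>Eventually each element has exactly one value, so for a compound term both sides say
  that v is the sum or product of the values of the arguments. A term has finitely many subterms, so
  their thresholds can be merged.\<close>

lemma term_at_iff_remainder:
  assumes "\<And>j. j \<in> fv_tm t \<Longrightarrow> rel M c (z j) (x j)" "\<And>j. x j \<in> dom M"
  shows "ev M c (\<lambda>i. \<forall>v\<in>nats M c. term_at t z i v \<longleftrightarrow> remainder M c (eval M x t) i v)"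
  using assms(1)
proof (induction t)
  case (Var j)
  then show ?case by (simp add: rel_def term_at_simps)
next
  case Zero
  show ?case
    using remainder_zero remainder_unique[OF in_dom(1) _ _ nats_zero _ remainder_zero]
    by (intro ev_const) (auto simp only: term_at_simps eval.simps)
next
  case One
  show ?case
    using remainder_one remainder_unique[OF in_dom(2) _ _ nats_one _ remainder_one]
    by (intro ev_const) (auto simp only: term_at_simps eval.simps)
next
  case (Add s t)
  have D: "eval M x s \<in> dom M" "eval M x t \<in> dom M" using assms(2) M by (auto intro: eval_in_dom)
  have s: "ev M c (\<lambda>i. \<forall>v\<in>nats M c. term_at s z i v \<longleftrightarrow> remainder M c (eval M x s) i v)"
    and t: "ev M c (\<lambda>i. \<forall>v\<in>nats M c. term_at t z i v \<longleftrightarrow> remainder M c (eval M x t) i v)"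
    using Add by auto
  show ?case
  proof (rule ev_mono[OF ev_conj[OF ev_conj[OF s t] ev_conj[OF ev_remainder[OF D(1)] ev_remainder[OF D(2)]]]])
    fix i assume i: "i \<in> nats M c"
    assume a: "((\<forall>v\<in>nats M c. term_at s z i v = remainder M c (eval M x s) i v) \<and>
          (\<forall>v\<in>nats M c. term_at t z i v = remainder M c (eval M x t) i v)) \<and>
         (\<exists>v\<in>nats M c. remainder M c (eval M x s) i v) \<and>
         (\<exists>v\<in>nats M c. remainder M c (eval M x t) i v)"
    then obtain v w where vw: "v \<in> nats M c" "w \<in> nats M c" "remainder M c (eval M x s) i v"
      "remainder M c (eval M x t) i w" by blast
    note r = remainder_arith[OF D i vw]
    have "term_at (Add s t) z i u \<longleftrightarrow> u = add M v w" if "u \<in> nats M c" for u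
      using a vw remainder_unique[OF D(1) i] remainder_unique[OF D(2) i]
      unfolding term_at_simps by metis
    moreover have "remainder M c (eval M x (Add s t)) i u \<longleftrightarrow> u = add M v w" if "u \<in> nats M c" for u
      using r(1,2) remainder_unique[OF in_dom(3)[OF D] i that r(1)] by auto
    ultimately show "\<forall>v\<in>nats M c. term_at (Add s t) z i v \<longleftrightarrow> remainder M c (eval M x (Add s t)) i v"
      by blast
  qed
next
  case (Mul s t)
  have D: "eval M x s \<in> dom M" "eval M x t \<in> dom M" using assms(2) M by (auto intro: eval_in_dom)
  have s: "ev M c (\<lambda>i. \<forall>v\<in>nats M c. term_at s z i v \<longleftrightarrow> remainder M c (eval M x s) i v)"
    and t: "ev M c (\<lambda>i. \<forall>v\<in>nats M c. term_at t z i v \<longleftrightarrow> remainder M c (eval M x t) i v)"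
    using Mul by auto
  show ?case
  proof (rule ev_mono[OF ev_conj[OF ev_conj[OF s t] ev_conj[OF ev_remainder[OF D(1)] ev_remainder[OF D(2)]]]])
    fix i assume i: "i \<in> nats M c"
    assume a: "((\<forall>v\<in>nats M c. term_at s z i v = remainder M c (eval M x s) i v) \<and>
          (\<forall>v\<in>nats M c. term_at t z i v = remainder M c (eval M x t) i v)) \<and>
         (\<exists>v\<in>nats M c. remainder M c (eval M x s) i v) \<and>
         (\<exists>v\<in>nats M c. remainder M c (eval M x t) i v)"
    then obtain v w where vw: "v \<in> nats M c" "w \<in> nats M c" "remainder M c (eval M x s) i v"
      "remainder M c (eval M x t) i w" by blast
    note r = remainder_arith[OF D i vw]
    have "term_at (Mul s t) z i u \<longleftrightarrow> u = mul M v w" if "u \<in> nats M c" for u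
      using a vw remainder_unique[OF D(1) i] remainder_unique[OF D(2) i]
      unfolding term_at_simps by metis
    moreover have "remainder M c (eval M x (Mul s t)) i u \<longleftrightarrow> u = mul M v w" if "u \<in> nats M c" for u
      using r(3,4) remainder_unique[OF in_dom(4)[OF D] i that r(3)] by auto
    ultimately show "\<forall>v\<in>nats M c. term_at (Mul s t) z i v \<longleftrightarrow> remainder M c (eval M x (Mul s t)) i v"
      by blast
  qed
qed

text \<open>The environment z holds codes, x the elements they stand for. Atoms are compared through
  eventual values, and quantifiers pass between codes and elements by \<open>ex_code\<close> and
  \<open>ex_elem\<close>. An element may have several codes, which is harmless because equality is
  translated as eventual equality of values.\<close>

lemma sat_tr:
  assumes "fv p \<subseteq> {..<k}" "\<And>j. j < k \<Longrightarrow> rel M c (z j) (x j)" "\<And>j. x j \<in> dom M"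
    "z k = c" "z (k + 1) = d"
  shows "sat M z (tr k p) \<longleftrightarrow> sat M x p"
  using assms
proof (induction p arbitrary: k z x)
  case (Eq s t)
  have D: "eval M x s \<in> dom M" "eval M x t \<in> dom M" using Eq.prems(3) M by (auto intro: eval_in_dom)
  have *: "sat M (case_nat v (case_nat i (case_nat N z))) (termF u 3 1 0 (k + 3)) \<longleftrightarrow> term_at u z i v"
    for v i N u
    unfolding term_at_def using Eq.prems(4)
    by (intro sat_termF) (simp_all add: numeral_eq_Suc)
  have "ev M c (\<lambda>i. \<forall>v\<in>nats M c. term_at u z i v \<longleftrightarrow> remainder M c (eval M x u) i v)"
    if "u \<in> {s, t}" for u
    using that Eq.prems by (intro term_at_iff_remainder) auto
  from ev_conj[OF this[of s] this[of t]]
  have "ev M c (\<lambda>i. (\<exists>v\<in>nats M c. term_at s z i v \<and> term_at t z i v) \<longleftrightarrow>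
      (\<exists>v\<in>nats M c. remainder M c (eval M x s) i v \<and> remainder M c (eval M x t) i v))"
    by (rule ev_mono) auto
  from ev_cong[OF this] show ?case
    using eq_iff_ev[OF D] Eq.prems(4) by (simp only: sat.simps tr.simps sat_evF sat_exN * ev_def) simp
next
  case (Less s t)
  have D: "eval M x s \<in> dom M" "eval M x t \<in> dom M" using Less.prems(3) M by (auto intro: eval_in_dom)
  have *: "sat M (case_nat w (case_nat v (case_nat i (case_nat N z)))) (termF u 4 2 l (k + 4)) \<longleftrightarrow>
      term_at u z i (case_nat w (\<lambda>_. v) l)" if "l < 2" for v w i N u l
    unfolding term_at_def using Less.prems(4) that
    by (intro sat_termF) (auto simp: numeral_eq_Suc less_Suc_eq split: nat.split)
  have "ev M c (\<lambda>i. \<forall>v\<in>nats M c. term_at u z i v \<longleftrightarrow> remainder M c (eval M x u) i v)"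
    if "u \<in> {s, t}" for u
    using that Less.prems by (intro term_at_iff_remainder) auto
  from ev_conj[OF this[of s] this[of t]]
  have "ev M c (\<lambda>i. (\<exists>v\<in>nats M c. \<exists>w\<in>nats M c. term_at s z i v \<and> term_at t z i w \<and> less M v w) \<longleftrightarrow>
      (\<exists>v\<in>nats M c. \<exists>w\<in>nats M c.
        remainder M c (eval M x s) i v \<and> remainder M c (eval M x t) i w \<and> less M v w))"
    by (rule ev_mono) auto
  from ev_cong[OF this] show ?case
    using less_iff_ev[OF D] Less.prems(4) *[of 0] *[of 1]
    by (simp add: ev_def numeral_2_eq_2 numeral_3_eq_3)
next
  case (Forall p)
  have fv: "fv p \<subseteq> {..<k + 1}" using Forall.prems(1) by (auto simp: subset_iff less_Suc_eq_0_disj)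
     (metis not0_implies_Suc)
  have IH: "sat M (case_nat w z) (tr (k + 1) p) \<longleftrightarrow> sat M (case_nat y x) p"
    if "rel M c w y" "y \<in> dom M" for w y
    using that Forall.prems fv by (intro Forall.IH) (auto split: nat.split)
  have "sat M z (tr k (Forall p)) \<longleftrightarrow>
      (\<forall>w\<in>dom M. le M w d \<longrightarrow> is_code M c w \<longrightarrow> sat M (case_nat w z) (tr (k + 1) p))"
    using Forall.prems(4,5) by simp
  also have "\<dots> \<longleftrightarrow> (\<forall>y\<in>dom M. sat M (case_nat y x) p)"
    using IH ex_code ex_elem by blast
  finally show ?case by simp
next
  case (Exists p)
  have fv: "fv p \<subseteq> {..<k + 1}" using Exists.prems(1) by (auto simp: subset_iff less_Suc_eq_0_disj)
     (metis not0_implies_Suc)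
  have IH: "sat M (case_nat w z) (tr (k + 1) p) \<longleftrightarrow> sat M (case_nat y x) p"
    if "rel M c w y" "y \<in> dom M" for w y
    using that Exists.prems fv by (intro Exists.IH) (auto split: nat.split)
  have "sat M z (tr k (Exists p)) \<longleftrightarrow>
      (\<exists>w\<in>dom M. le M w d \<and> is_code M c w \<and> sat M (case_nat w z) (tr (k + 1) p))"
    using Exists.prems(4,5) by simp
  also have "\<dots> \<longleftrightarrow> (\<exists>y\<in>dom M. sat M (case_nat y x) p)"
    using IH ex_code ex_elem by blast
  finally show ?case by simp
next
  case (Imp p q)
  have "sat M z (tr k p) \<longleftrightarrow> sat M x p" "sat M z (tr k q) \<longleftrightarrow> sat M x q"
    using Imp.prems by (intro Imp.IH; simp)+
  then show ?case by simp
next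
  case (Conj p q)
  have "sat M z (tr k p) \<longleftrightarrow> sat M x p" "sat M z (tr k q) \<longleftrightarrow> sat M x q"
    using Conj.prems by (intro Conj.IH; simp)+
  then show ?case by simp
next
  case (Disj p q)
  have "sat M z (tr k p) \<longleftrightarrow> sat M x p" "sat M z (tr k q) \<longleftrightarrow> sat M x q"
    using Disj.prems by (intro Disj.IH; simp)+
  then show ?case by simp
qed simp

end

lemma sat_star:
  fixes M :: "'a model"
  assumes M: "is_model M" and e: "\<And>i. e i \<in> dom M" and Phi: "sat M e PhiF" and p: "sentence p"
  shows "sat M e (star p) \<longleftrightarrow> sat M e p"
proof -
  have tr: "sat M (case_nat c (case_nat d e)) (tr 0 p) \<longleftrightarrow> sat M e p"
    if "c \<in> dom M" "d \<in> dom M" "delta M c d" for c d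
  proof -
    have "reflects M c d" using Phi that by (auto simp: PhiF_def sat_reflectF)
    then interpret reflecting M c d using M that by unfold_locales
    show ?thesis using p e by (intro sat_tr) (auto simp: sentence_def)
  qed
  have "\<exists>d\<in>dom M. \<exists>c\<in>dom M. delta M c d" using Phi by (simp add: PhiF_def)
  then show ?thesis using tr by (auto simp: star_def)
qed

section \<open>The model of polynomials\<close>

definition poly_model :: "int poly model" where
  "poly_model = \<lparr>dom = {p. 0 \<le> p}, zero = 0, one = 1, add = (+), mul = (*), less = (<)\<rparr>"

lemma poly_model_simps [simp]:
  "dom poly_model = {p. 0 \<le> p}" "zero poly_model = 0" "one poly_model = 1"
  "add poly_model = (+)" "mul poly_model = (*)" "less poly_model = (<)"
  "le poly_model p q \<longleftrightarrow> p \<le> q"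
  by (auto simp: poly_model_def le_def)

lemma is_model_poly_model: "is_model poly_model"
  by (simp add: is_model_def)

lemma nonneg_pCons_iff: "0 \<le> pCons a (p :: int poly) \<longleftrightarrow> 0 < p \<or> p = 0 \<and> 0 \<le> a"
  by (auto simp: less_eq_poly_def less_poly_def pos_poly_pCons)

lemma le_of_nat_int_poly:
  assumes "0 \<le> (p :: int poly)" "p \<le> of_nat n"
  obtains k where "p = of_nat k"
proof -
  obtain b r where p: "p = pCons b r" by (cases p)
  have "0 \<le> of_nat n - p" using assms(2) by simp
  then have "0 \<le> pCons (int n - b) (- r)" by (simp add: p of_nat_poly del: diff_ge_0_iff_ge)
  then have "r = 0" "b \<ge> 0" using assms(1) unfolding p nonneg_pCons_iff by auto
  then have "p = of_nat (nat b)" by (simp add: p of_nat_poly)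
  then show ?thesis using that by blast
qed

text \<open>For p = a + X q with q \<ge> 1 the difference p - (X + a) is X (q - 1).\<close>

lemma linear_le_poly:
  assumes "0 \<le> (p :: int poly)" "\<nexists>n. p = of_nat n"
  obtains m where "[:m, 1:] \<le> p"
proof -
  obtain a q where p: "p = pCons a q" by (cases p)
  have "q \<noteq> 0"
  proof
    assume "q = 0"
    then have "a \<ge> 0" using assms(1) by (simp add: p nonneg_pCons_iff)
    then have "p = of_nat (nat a)" by (simp add: p \<open>q = 0\<close> of_nat_poly)
    then show False using assms(2) by blast
  qed
  then have "q \<ge> 1" using assms(1) int_poly_discrete by (simp add: p nonneg_pCons_iff)
  then have "0 \<le> pCons (a - a) (q - 1)" unfolding nonneg_pCons_iff by auto
  also have "pCons (a - a) (q - 1) = p - [:a, 1:]" by (simp add: p one_pCons)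
  finally show ?thesis using that by simp
qed

text \<open>A nonstandard x has some X + m below it, whose coefficient 1 at X is odd, so X + m is
  neither h + h nor h + h + 1.\<close>

lemma natural_poly_model:
  assumes "0 \<le> x"
  shows "natural poly_model x \<longleftrightarrow> (\<exists>n. x = of_nat n)"
proof
  assume nat: "natural poly_model x"
  show "\<exists>n. x = of_nat n"
  proof (rule ccontr)
    assume "\<not> ?thesis"
    then obtain m where m: "[:m, 1:] \<le> x" using linear_le_poly assms by blast
    have "0 \<le> [:m, 1:]" by (simp add: nonneg_pCons_iff less_poly_def pos_poly_pCons)
    with nat m obtain h where "[:m, 1:] = h + h \<or> [:m, 1:] = h + h + 1"
      by (auto simp: natural_def)
    then have "coeff [:m, 1:] 1 = coeff (h + h) 1 \<or> coeff [:m, 1:] 1 = coeff (h + h + 1) 1" by metis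
    then have "1 = coeff h 1 + coeff h 1" unfolding coeff_add by (simp add: one_pCons)
    then show False by presburger
  qed
next
  assume "\<exists>n. x = of_nat n"
  then obtain n where n: "x = of_nat n" by blast
  show "natural poly_model x" unfolding natural_def
  proof (intro ballI impI)
    fix w assume "w \<in> dom poly_model" "le poly_model w x"
    then obtain k where w: "w = of_nat k" using le_of_nat_int_poly[of w n] n by auto
    have "k = k div 2 + k div 2 \<or> k = k div 2 + k div 2 + 1" by presburger
    then have "w = of_nat (k div 2) + of_nat (k div 2) \<or> w = of_nat (k div 2) + of_nat (k div 2) + 1"
      unfolding w by (metis of_nat_1 of_nat_add)
    then show "\<exists>h\<in>dom poly_model. le poly_model h w \<and>
        (w = add poly_model h h \<or> w = add poly_model (add poly_model h h) (one poly_model))"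
      by (intro bexI[of _ "of_nat (k div 2)"]) (auto simp: w)
  qed
qed

text \<open>As c is not a number, some X + m lies below it; this is not a number either, so by
  \<open>delta\<close> it differs from c by one.\<close>

lemma delta_poly_model:
  assumes "0 \<le> c" "delta poly_model c d"
  obtains m where "c = [:m, 1:]" "d = c * (c * c)"
proof -
  obtain m where m: "[:m, 1:] \<le> c"
    using linear_le_poly assms natural_poly_model[of c] by (auto simp: delta_def)
  have nonneg: "0 \<le> [:m, 1:]" by (simp add: nonneg_pCons_iff less_poly_def pos_poly_pCons)
  have "\<not> natural poly_model [:m, 1:]"
    by (simp add: natural_poly_model nonneg of_nat_poly)
  then obtain n where "n \<in> nats poly_model c" "[:m, 1:] + n = c"
    using assms m nonneg by (auto simp: delta_def)
  then obtain k where "c = [:m, 1:] + of_nat k" by (auto simp: nats_def natural_poly_model)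
  then have "c = [:m + int k, 1:]" by (simp add: of_nat_poly)
  then show ?thesis using that assms(2) by (auto simp: delta_def)
qed

definition nat_of :: "int poly \<Rightarrow> nat" where
  "nat_of p = nat (coeff p 0)"

lemma nat_of_of_nat [simp]: "nat_of (of_nat n) = n" "nat_of 0 = 0"
  by (simp_all add: nat_of_def of_nat_poly)

context
  fixes m :: int and c assumes c: "c = [:m, 1:]"
begin

lemma c_nonneg: "0 \<le> c"
  by (simp add: c nonneg_pCons_iff less_poly_def pos_poly_pCons)

lemma of_nat_le_c: "of_nat n \<le> c"
  by (simp add: c of_nat_poly less_eq_poly_def pos_poly_pCons)

lemma nats_poly_model: "nats poly_model c = range of_nat"
  by (auto simp: nats_def natural_poly_model of_nat_le_c)

lemma delta_poly_model_c: "delta poly_model c (c * (c * c))"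
  unfolding delta_def
proof (intro conjI ballI impI)
  show "\<not> natural poly_model c"
    unfolding natural_poly_model[OF c_nonneg] by (simp add: c of_nat_poly)
  fix x assume x: "x \<in> dom poly_model" "le poly_model x c"
  obtain a r where a: "x = pCons a r" by (cases x)
  have "0 \<le> c - x" using x(2) by simp
  then have "0 \<le> pCons (m - a) (1 - r)" by (simp add: a c one_pCons del: diff_ge_0_iff_ge)
  then have le: "r < 1 \<or> r = 1 \<and> a \<le> m" by (simp add: nonneg_pCons_iff)
  have "r > 0 \<or> r = 0 \<and> a \<ge> 0" using x(1) by (simp add: a nonneg_pCons_iff)
  \<comment> \<open>Discreteness leaves only 0 and 1 for r, since a positive polynomial is at least
    1.\<close>
  then consider "r = 1" "a \<le> m" | "r = 0" "a \<ge> 0"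
    using le int_poly_discrete[of r] by force
  then show "natural poly_model x \<or> (\<exists>n\<in>nats poly_model c. add poly_model x n = c)"
  proof cases
    case 1
    then have "x + of_nat (nat (m - a)) = c" by (simp add: a c of_nat_poly one_pCons)
    then show ?thesis by (auto simp: nats_poly_model)
  next
    case 2
    then have "x = of_nat (nat a)" by (simp add: a of_nat_poly)
    then show ?thesis using x by (auto simp: natural_poly_model)
  qed
qed simp

lemma ev_poly_model: "ev poly_model c P \<longleftrightarrow> (\<exists>N::nat. \<forall>i\<ge>N. P (of_nat i))"
  by (auto simp: ev_def nats_poly_model)

lemma remainder_poly_model:
  assumes "0 \<le> x"
  shows "remainder poly_model c x (of_nat i) (of_nat v) \<longleftrightarrow> poly x (int i - m) = int v"
proof -
  have "y + of_nat i = c \<longleftrightarrow> y = [:m - int i, 1:]" for y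
    by (auto simp: c of_nat_poly eq_diff_eq[symmetric])
  moreover have "0 \<le> [:m - int i, 1:]" by (simp add: nonneg_pCons_iff less_poly_def pos_poly_pCons)
  ultimately show ?thesis
    unfolding int_poly_remainder[OF assms] by (auto simp: remainder_def of_nat_poly)
qed

lemma sat_betaF_poly_model:
  assumes "e u \<in> range of_nat" "e w \<in> range of_nat" "e l \<in> range of_nat" "e x \<in> range of_nat"
    and "e k = c"
  shows "sat poly_model e (betaF u w l x k) \<longleftrightarrow>
    beta (nat_of (e u)) (nat_of (e w)) (nat_of (e l)) = nat_of (e x)"
proof -
  obtain u' w' l' x' where e: "e u = of_nat u'" "e w = of_nat w'" "e l = of_nat l'" "e x = of_nat x'"
    using assms by auto
  define d where "d = 1 + (l' + 1) * w'"
  have "sat poly_model e (betaF u w l x k) \<longleftrightarrow>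
      (\<exists>q::nat. of_nat u' = of_nat q * (1 + (of_nat l' + 1) * of_nat w') + (of_nat x' :: int poly) \<and>
        of_nat x' < 1 + (of_nat l' + 1) * (of_nat w' :: int poly))"
    by (simp add: betaF_def modulus_def nats_poly_model assms(5) e)
  also have "\<dots> \<longleftrightarrow> (\<exists>q. u' = q * d + x' \<and> x' < d)"
    unfolding of_nat_1[where 'a="int poly", symmetric] of_nat_add[symmetric] of_nat_mult[symmetric] of_nat_eq_iff
      of_nat_less_iff d_def ..
  also have "\<dots> \<longleftrightarrow> u' mod d = x'"
  proof
    assume "u' mod d = x'"
    moreover have "d > 0" by (simp add: d_def)
    ultimately show "\<exists>q. u' = q * d + x' \<and> x' < d"
      by (intro exI[of _ "u' div d"]) auto
  qed auto
  finally show ?thesis by (simp add: e beta_def d_def)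
qed

lemma sat_stepF_poly_model:
  assumes "e u = of_nat u'" "e w = of_nat w'" "e s = of_nat s'" "e t = of_nat t'" "e j = of_nat j'"
    "e l = of_nat l'" "e k = c"
  shows "sat poly_model e (stepF u w s t j l k) \<longleftrightarrow>
    beta u' w' (Suc l') = beta u' w' l' * j' + beta s' t' l'"
proof -
  have eq: "of_nat a = of_nat b + (1 :: int poly) \<longleftrightarrow> a = Suc b"
    "of_nat a = of_nat b * of_nat d + (of_nat f :: int poly) \<longleftrightarrow> a = b * d + f" for a b d f
    unfolding of_nat_1[where 'a="int poly", symmetric] of_nat_add[symmetric] of_nat_mult[symmetric] of_nat_eq_iff by auto
  define body where "body = Conj (betaF (u + 4) (w + 4) (l + 4) 3 (k + 4))
     (Conj (betaF (s + 4) (t + 4) (l + 4) 2 (k + 4))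
     (Conj (Eq (Var 1) (Add (Var (l + 4)) One))
     (Conj (Eq (Var 0) (Add (Mul (Var 3) (Var (j + 4))) (Var 2)))
       (betaF (u + 4) (w + 4) 1 0 (k + 4)))))"
  have "sat poly_model (case_nat (of_nat p') (case_nat (of_nat l'') (case_nat (of_nat y)
      (case_nat (of_nat p) e)))) body \<longleftrightarrow> beta u' w' l' = p \<and> beta s' t' l' = y \<and> l'' = Suc l' \<and>
        p' = p * j' + y \<and> beta u' w' l'' = p'" for p y l'' p'
    by (simp add: body_def sat_betaF_poly_model assms eq numeral_eq_Suc)
  moreover have "sat poly_model e (stepF u w s t j l k) \<longleftrightarrow>
      sat poly_model e (exN k (exN (k + 1) (exN (k + 2) (exN (k + 3) body))))"
    by (simp only: stepF_def body_def)
  ultimately show ?thesis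
    by (simp add: nats_poly_model assms numeral_eq_Suc)
qed

lemma sat_hornerF_poly_model:
  assumes "e s \<in> range of_nat" "e t \<in> range of_nat" "e n \<in> range of_nat" "e j \<in> range of_nat"
    and "e v \<in> range of_nat" "e k = c"
  shows "sat poly_model e (hornerF s t n j v k) \<longleftrightarrow>
    horner (beta (nat_of (e s)) (nat_of (e t))) (nat_of (e j)) (nat_of (e n)) = nat_of (e v)"
proof -
  obtain s' t' n' j' v' where e: "e s = of_nat s'" "e t = of_nat t'" "e n = of_nat n'"
    "e j = of_nat j'" "e v = of_nat v'" using assms by auto
  show ?thesis
    unfolding hornerF_def horner_iff_beta
    by (simp add: nats_poly_model assms(6) e sat_betaF_poly_model numeral_eq_Suc
        sat_stepF_poly_model[where s'=s' and t'=t' and j'=j'])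
qed

definition pack :: "nat \<Rightarrow> nat \<Rightarrow> nat \<Rightarrow> int poly" where
  "pack s t n = of_nat s + c * (of_nat t + c * of_nat n)"

text \<open>The powers 1, c, c^2 have degrees 0, 1, 2 in X, so comparing coefficients recovers n,
  then t, then s.\<close>

lemma pack_inject: "pack s t n = pack s' t' n' \<longleftrightarrow> s = s' \<and> t = t' \<and> n = n'"
  unfolding pack_def by (auto simp: c of_nat_poly)

lemma pack_nonneg: "0 \<le> pack s t n"
  unfolding pack_def using c_nonneg by (intro add_nonneg_nonneg mult_nonneg_nonneg) auto

text \<open>A code has degree at most 2 in X, while the bound is monic of degree 3.\<close>

lemma pack_le: "pack s t n \<le> c * (c * c)"
  unfolding pack_def by (simp add: c of_nat_poly less_eq_poly_def pos_poly_pCons)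

lemma is_code_poly_model: "is_code poly_model c z \<longleftrightarrow> (\<exists>s t n. z = pack s t n)"
  by (simp add: is_code_def codeF_def packF_def nats_poly_model pack_def numeral_eq_Suc)

lemma code_val_poly_model:
  "code_val poly_model c (pack s t n) (of_nat i) (of_nat v) \<longleftrightarrow>
     i \<ge> n \<and> horner (beta s t) (i - n) n = v"
proof -
  have eq: "of_nat a = of_nat b + (of_nat d :: int poly) \<longleftrightarrow> a = b + d" for a b d
    unfolding of_nat_add[symmetric] of_nat_eq_iff ..
  have "code_val poly_model c (pack s t n) (of_nat i) (of_nat v) \<longleftrightarrow>
      (\<exists>s' t' n' j. pack s t n = pack s' t' n' \<and> i = n' + j \<and> horner (beta s' t') j n' = v)"
    by (simp add: code_val_def valueF_def packF_def nats_poly_model eq numeral_eq_Suc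
        sat_hornerF_poly_model pack_def[of _ _ n' for n'])
  also have "\<dots> \<longleftrightarrow> i \<ge> n \<and> horner (beta s t) (i - n) n = v"
    unfolding pack_inject by (auto intro: exI[of _ "i - n"])
  finally show ?thesis .
qed

lemma rel_pack_iff:
  assumes "0 \<le> x"
  shows "rel poly_model c (pack s t n) x \<longleftrightarrow> (\<exists>N. \<forall>i\<ge>N. \<forall>v.
    (i \<ge> n \<and> horner (beta s t) (i - n) n = v) \<longleftrightarrow> poly x (int i - m) = int v)"
  by (simp add: rel_def ev_poly_model nats_poly_model code_val_poly_model remainder_poly_model assms)

lemma reflects_poly_model: "reflects poly_model c (c * (c * c))"
proof -
  let ?M = poly_model
  have eq: "of_nat a + of_nat b = (of_nat (a + b) :: int poly)"
    "of_nat a * of_nat b = (of_nat (a * b) :: int poly)" for a b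
    by simp_all
  have h1: "\<forall>x\<in>dom ?M. \<exists>z\<in>dom ?M. le ?M z (c * (c * c)) \<and> is_code ?M c z \<and> rel ?M c z x"
  proof
    fix x assume x: "x \<in> dom ?M"
    obtain s t n where stn: "\<forall>i\<ge>n. poly x (int i - m) = int (horner (beta s t) (i - n) n)"
      using nonneg_poly_code x by fastforce
    have "rel ?M c (pack s t n) x"
      using x stn
      by (subst rel_pack_iff) (auto intro!: exI[of _ n])
    then show "\<exists>z\<in>dom ?M. le ?M z (c * (c * c)) \<and> is_code ?M c z \<and> rel ?M c z x"
      by (intro bexI[of _ "pack s t n"]) (auto simp: is_code_poly_model pack_le pack_nonneg)
  qed
  have h2: "\<forall>z\<in>dom ?M. le ?M z (c * (c * c)) \<longrightarrow> is_code ?M c z \<longrightarrow> (\<exists>x\<in>dom ?M. rel ?M c z x)"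
  proof (intro ballI impI)
    fix z assume "is_code ?M c z"
    then obtain s t n where z: "z = pack s t n" by (auto simp: is_code_poly_model)
    obtain x :: "int poly" where x: "x \<ge> 0"
      "\<forall>i\<ge>n. poly x (int i - m) = int (horner (beta s t) (i - n) n)"
      using poly_code_nonneg by blast
    then have "rel ?M c z x" unfolding z by (subst rel_pack_iff) (auto intro!: exI[of _ n])
    then show "\<exists>x\<in>dom ?M. rel ?M c z x" using x by auto
  qed
  have h3: "\<forall>a\<in>nats ?M c. \<forall>b\<in>nats ?M c. ev ?M c (\<lambda>i. le ?M a i \<and> le ?M b i)"
    by (simp add: nats_poly_model ev_poly_model) (metis max.bounded_iff)
  have h4: "\<forall>x\<in>dom ?M. ev ?M c (\<lambda>i. \<exists>v\<in>nats ?M c. remainder ?M c x i v)"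
  proof
    fix x assume x: "x \<in> dom ?M"
    obtain N :: nat where "\<forall>i\<ge>N. poly x (int i - m) \<ge> 0" using int_poly_nonneg_nat[of x m] x by auto
    then have "\<forall>i\<ge>N. \<exists>v. poly x (int i - m) = int v" by (metis nonneg_int_cases)
    then show "ev ?M c (\<lambda>i. \<exists>v\<in>nats ?M c. remainder ?M c x i v)"
      using x by (auto simp: ev_poly_model nats_poly_model remainder_poly_model)
  qed
  have h5: "\<forall>x\<in>dom ?M. \<forall>i\<in>nats ?M c. \<forall>v\<in>nats ?M c. \<forall>w\<in>nats ?M c.
      remainder ?M c x i v \<longrightarrow> remainder ?M c x i w \<longrightarrow> v = w"
    by (simp add: nats_poly_model remainder_poly_model)
  have nat: "of_nat k \<le> c \<and> natural ?M (of_nat k)" for k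
    using of_nat_le_c by (auto simp: natural_poly_model)
  have h6: "\<forall>a\<in>dom ?M. \<forall>b\<in>dom ?M. a = zero ?M \<longrightarrow> b = one ?M \<longrightarrow>
      (le ?M a c \<and> natural ?M a) \<and> (le ?M b c \<and> natural ?M b) \<and>
      (\<forall>j\<in>nats ?M c. remainder ?M c a j a \<and> remainder ?M c b j b)"
  proof (intro ballI impI)
    fix a b assume "a = zero ?M" "b = one ?M"
    then have ab: "a = of_nat 0" "b = of_nat 1" by simp_all
    have "remainder ?M c (of_nat k) (of_nat j) (of_nat k)" for k j
      by (simp add: remainder_poly_model)
    then show "(le ?M a c \<and> natural ?M a) \<and> (le ?M b c \<and> natural ?M b) \<and>
      (\<forall>j\<in>nats ?M c. remainder ?M c a j a \<and> remainder ?M c b j b)"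
      unfolding ab nats_poly_model poly_model_simps using nat by blast
  qed
  have h7: "\<forall>x\<in>dom ?M. \<forall>y\<in>dom ?M. \<forall>i\<in>nats ?M c. \<forall>v\<in>nats ?M c. \<forall>w\<in>nats ?M c.
      remainder ?M c x i v \<longrightarrow> remainder ?M c y i w \<longrightarrow> (\<forall>z\<in>dom ?M. \<forall>u\<in>dom ?M.
      (z = add ?M x y \<longrightarrow> u = add ?M v w \<longrightarrow> (le ?M u c \<and> natural ?M u) \<and> remainder ?M c z i u) \<and>
      (z = mul ?M x y \<longrightarrow> u = mul ?M v w \<longrightarrow> (le ?M u c \<and> natural ?M u) \<and> remainder ?M c z i u))"
  proof (intro ballI)
    fix x y i v w assume as: "x \<in> dom ?M" "y \<in> dom ?M" "i \<in> nats ?M c" "v \<in> nats ?M c" "w \<in> nats ?M c"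
    then obtain i' v' w' where i': "i = of_nat i'" "v = of_nat v'" "w = of_nat w'"
      by (auto simp: nats_poly_model)
    have xy: "0 \<le> x" "0 \<le> y" "0 \<le> x + y" "0 \<le> x * y" using as by simp_all
    \<comment> \<open>Evaluation at \<open>int i - m\<close> is a ring homomorphism.\<close>
    have "remainder ?M c x i v \<Longrightarrow> remainder ?M c y i w \<Longrightarrow>
        remainder ?M c (x + y) i (of_nat (v' + w')) \<and> remainder ?M c (x * y) i (of_nat (v' * w'))"
      using xy by (simp add: i' remainder_poly_model del: of_nat_add of_nat_mult) simp
    then show "remainder ?M c x i v \<longrightarrow> remainder ?M c y i w \<longrightarrow> (\<forall>z\<in>dom ?M. \<forall>u\<in>dom ?M.
      (z = add ?M x y \<longrightarrow> u = add ?M v w \<longrightarrow> (le ?M u c \<and> natural ?M u) \<and> remainder ?M c z i u) \<and>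
      (z = mul ?M x y \<longrightarrow> u = mul ?M v w \<longrightarrow> (le ?M u c \<and> natural ?M u) \<and> remainder ?M c z i u))"
      unfolding poly_model_simps i' eq using nat by blast
  qed
  have h8: "x = y \<longleftrightarrow> ev ?M c (\<lambda>i. \<exists>v\<in>nats ?M c. remainder ?M c x i v \<and> remainder ?M c y i v)"
    "less ?M x y \<longleftrightarrow> ev ?M c (\<lambda>i. \<exists>v\<in>nats ?M c. \<exists>w\<in>nats ?M c.
          remainder ?M c x i v \<and> remainder ?M c y i w \<and> less ?M v w)"
    if "x \<in> dom ?M" "y \<in> dom ?M" for x y
  proof -
    have xy: "0 \<le> x" "0 \<le> y" using that by auto
    obtain a b :: nat where ab: "\<forall>i\<ge>a. poly x (int i - m) \<ge> 0" "\<forall>i\<ge>b. poly y (int i - m) \<ge> 0"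
      using int_poly_nonneg_nat[of x m] int_poly_nonneg_nat[of y m] xy by auto
    have "x = y \<longleftrightarrow> (\<exists>N::nat. \<forall>i\<ge>N. poly x (int i - m) = poly y (int i - m))"
      by (rule int_poly_eq_iff_nat)
    also have "\<dots> \<longleftrightarrow> (\<exists>N. \<forall>i\<ge>N. \<exists>v. poly x (int i - m) = int v \<and> poly y (int i - m) = int v)"
    proof
      assume "\<exists>N::nat. \<forall>i\<ge>N. poly x (int i - m) = poly y (int i - m)"
      then obtain N :: nat where N: "\<forall>i\<ge>N. poly x (int i - m) = poly y (int i - m)" by blast
      show "\<exists>N. \<forall>i\<ge>N. \<exists>v. poly x (int i - m) = int v \<and> poly y (int i - m) = int v"
        \<comment> \<open>Beyond \<open>a\<close> the value of x is nonnegative, so the common value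
          is a natural number.\<close>
        using N ab by (intro exI[of _ "max N a"]) (metis max.bounded_iff nonneg_int_cases)
    qed metis
    finally show "x = y \<longleftrightarrow> ev ?M c (\<lambda>i. \<exists>v\<in>nats ?M c. remainder ?M c x i v \<and> remainder ?M c y i v)"
      using xy by (simp add: ev_poly_model nats_poly_model remainder_poly_model)
    have "x < y \<longleftrightarrow> (\<exists>N::nat. \<forall>i\<ge>N. poly x (int i - m) < poly y (int i - m))"
      by (rule int_poly_less_iff_nat)
    also have "\<dots> \<longleftrightarrow> (\<exists>N. \<forall>i\<ge>N. \<exists>v w. poly x (int i - m) = int v \<and> poly y (int i - m) = int w \<and> v < w)"
    proof
      assume "\<exists>N::nat. \<forall>i\<ge>N. poly x (int i - m) < poly y (int i - m)"
      then obtain N :: nat where N: "\<forall>i\<ge>N. poly x (int i - m) < poly y (int i - m)" by blast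
      show "\<exists>N. \<forall>i\<ge>N. \<exists>v w. poly x (int i - m) = int v \<and> poly y (int i - m) = int w \<and> v < w"
      proof (rule exI[of _ "max N (max a b)"], intro allI impI)
        fix i assume "max N (max a b) \<le> i"
        then have "poly x (int i - m) \<ge> 0" "poly y (int i - m) \<ge> 0"
          "poly x (int i - m) < poly y (int i - m)" using N ab by auto
        then show "\<exists>v w. poly x (int i - m) = int v \<and> poly y (int i - m) = int w \<and> v < w"
          by (intro exI[of _ "nat (poly x (int i - m))"] exI[of _ "nat (poly y (int i - m))"]) auto
      qed
    qed (metis of_nat_less_iff)
    finally show "less ?M x y \<longleftrightarrow> ev ?M c (\<lambda>i. \<exists>v\<in>nats ?M c. \<exists>w\<in>nats ?M c.
          remainder ?M c x i v \<and> remainder ?M c y i w \<and> less ?M v w)"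
      using xy by (simp add: ev_poly_model nats_poly_model remainder_poly_model)
  qed
  show ?thesis
    unfolding reflects_def by (intro conjI h1 h2 h3 h4 h5 h6 h7) (intro ballI conjI h8; assumption)
qed

end

text \<open>Every admissible c has the form X + m, for which reflection is known; c = X, the case m
  = 0, shows that one exists.\<close>

lemma sat_PhiF_poly_model: "sat poly_model e PhiF"
proof -
  have "reflects poly_model c d" if "0 \<le> c" "delta poly_model c d" for c d
    using that reflects_poly_model by (metis delta_poly_model)
  moreover have "\<exists>d. 0 \<le> d \<and> (\<exists>c. 0 \<le> c \<and> delta poly_model c d)"
    using delta_poly_model_c[OF refl, of 0] c_nonneg[OF refl, of 0] by (metis mult_nonneg_nonneg)
  ultimately show ?thesis by (simp add: PhiF_def sat_reflectF)
qed

text \<open>Subtraction and discreteness are prepared separately; the other axioms are laws of the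
  ordered ring \<open>int poly\<close> on nonnegative elements.\<close>

lemma sat_PA_minus_poly_model: "p \<in> PA_minus_axioms \<Longrightarrow> sat poly_model e p"
proof -
  have "\<exists>z\<ge>0. x + z = y" if "x < y" for x y :: "int poly"
    using that by (intro exI[of _ "y - x"]) simp
  moreover have "x = 1 \<or> 1 < x" if "0 < x" for x :: "int poly"
    using int_poly_discrete[OF that] by auto
  ultimately show "p \<in> PA_minus_axioms \<Longrightarrow> sat poly_model e p"
    unfolding PA_minus_axioms_def
    by (elim insertE emptyE; simp add: numeral_eq_Suc algebra_simps mult_strict_left_mono; auto)
qed

theorem theorem4p1:
  "\<exists>\<Phi> X. sentence \<Phi> \<and> (\<forall>\<sigma>\<in>X. sentence \<sigma> \<and> Sigma1 \<sigma>) \<and>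
     completion_of PA_minus (deductive_closure ({\<Phi>} \<union> X))"
proof -
  define zero_env :: "nat \<Rightarrow> int poly" where "zero_env = (\<lambda>_. 0)"
  \<comment> \<open>Translations are selected by truth of the original sentence; \<open>star\<close>
    below shows that they are then true themselves.\<close>
  define X where "X = {star p |p. sentence p \<and> sat poly_model zero_env p}"
  let ?T = "{PhiF} \<union> X"
  have X: "\<forall>\<sigma>\<in>X. sentence \<sigma> \<and> Sigma1 \<sigma>" by (auto simp: X_def sentence_star Sigma1_star)
  have T: "sentence q" if "q \<in> ?T" for q using that sentence_PhiF X by auto
  have env: "zero_env i \<in> dom poly_model" for i by (simp add: zero_env_def)
  have X_intro: "star p \<in> ?T" if "sentence p" "sat poly_model zero_env p" for p
    using that by (auto simp: X_def)
  have star: "sat poly_model zero_env (star p) \<longleftrightarrow> sat poly_model zero_env p" if "sentence p" for p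
    by (rule sat_star[OF is_model_poly_model env sat_PhiF_poly_model that])
  have sat_T: "sat poly_model zero_env q" if "q \<in> ?T" for q
    using that star sat_PhiF_poly_model by (auto simp: X_def)
  have sound_T: "sat poly_model zero_env p" if "?T \<turnstile> p" for p
    by (rule soundness[OF that is_model_poly_model env sat_T])
  \<comment> \<open>Every model of the axioms satisfies \<open>PhiF\<close> and
    \<open>star p\<close>, hence p; completeness turns this into a derivation.\<close>
  have derivable: "?T \<turnstile> p" if p: "sentence p" "sat poly_model zero_env p" for p
  proof (rule completeness[OF T p(1)])
    fix M :: "tm model" and e
    assume M: "is_model M" "\<And>i. e i \<in> dom M" "\<And>q. q \<in> ?T \<Longrightarrow> sat M e q"
    have "sat M e PhiF" by (rule M(3)) simp
    moreover have "sat M e (star p)" using p by (intro M(3) X_intro)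
    ultimately show "sat M e p" using sat_star[of M e p, OF M(1,2) _ p(1)] by blast
  qed
  have iff: "?T \<turnstile> p \<longleftrightarrow> sat poly_model zero_env p" if "sentence p" for p
    using derivable[OF that] sound_T by blast
  let ?S = "deductive_closure ?T"
  have S: "?S = {p. sentence p \<and> sat poly_model zero_env p}"
    using iff by (auto simp: deductive_closure_def)
  have sound_S: "sat poly_model zero_env p" if "?S \<turnstile> p" for p
    by (rule soundness[OF that is_model_poly_model env]) (use S in blast)
  have "deductive_closure ?S = ?S"
    unfolding deductive_closure_def[of ?S] using sound_S S by (auto intro: Assm)
  moreover have "consistent ?S" using sound_S[of Falsum] by (auto simp: consistent_def)
  moreover have "Defs.complete ?S"
    unfolding Defs.complete_def
  proof (intro allI impI)
    fix p assume p: "sentence p"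
    then have "p \<in> ?S \<or> Neg p \<in> ?S" unfolding S by (auto simp: sentence_def)
    then show "?S \<turnstile> p \<or> ?S \<turnstile> Neg p" by (auto intro: Assm)
  qed
  moreover have "PA_minus \<subseteq> ?S"
  proof
    fix p assume "p \<in> PA_minus"
    then have p: "sentence p" "PA_minus_axioms \<turnstile> p"
      by (simp_all add: PA_minus_def deductive_closure_def)
    have "sat poly_model zero_env p"
      by (rule soundness[OF p(2) is_model_poly_model env sat_PA_minus_poly_model])
    then show "p \<in> ?S" unfolding S using p(1) by simp
  qed
  ultimately show ?thesis using sentence_PhiF X unfolding completion_of_def is_theory_def by blast
qed

end
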